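(* If a configuration $C=p_r\dots p_s$ of g-2PATH is of Type I, then $\mathrm{mft}_{\text{g-2PATH}}(C)=-r+s+\max\{-r,s\}$.
   Context: Positions are elements of $\mathbb{Z}^2$; with $\epsilon_0=(1,0),\epsilon_1=(0,1),\epsilon_2=(-1,0),\epsilon_3=(0,-1)$, positions $p,p'$ are adjacent if $p'-p$ is some $\epsilon_i$. A configuration of g-2PATH is a sequence $C=p_r\dots p_s$ ($r\le0\le s$) of positions with $p_0=(0,0)$ (the general), consecutive positions adjacent, all positions distinct, and $p_l,p_m$ not adjacent whenever $|l-m|\ge2$. For $p\in C$, $\mathrm{bc}_C(p)=(b_0,\dots,b_3)$ with $b_i=1$ iff $p+\epsilon_i\in C$. Firing squad model (boundary-sensitive): a finite automaton $A$ has a finite state set with quiescent state $\mathrm{Q}$, general states $\mathrm{G}_0,\dots,\mathrm{G}_{m-1}$, firing states $\mathcal F\not\ni\mathrm{Q}$, a map $\tau:\{0,1\}^4\to\{0,\dots,m-1\}$ and a transition function from the current state and the four neighbour states ($\#$ where no node), with $\mathrm{Q}$ stable when all inputs are in $\{\mathrm{Q},\#\}$. On $C$, at time $0$ node $(0,0)$ is in $\mathrm{G}_{\tau(\mathrm{bc}_C((0,0)))}$, others in $\mathrm{Q}$, synchronous updates. $A$ is a solution of g-2PATH if for every configuration $C$ there is $t_C$ with no node in $\mathcal F$ before $t_C$ and all nodes in $\mathcal F$ at $t_C=:\mathrm{ft}(C,A)$. $\mathrm{mft}_{\text{g-2PATH}}(C)=\min_A\mathrm{ft}(C,A)$ over solutions.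 For $r\le i\le0\le j\le s$, $W(i,j)$ is the set of pairs $(x_0,x_1)$ of finite, possibly empty, sequences of positions such that $x_0p_i\dots p_jx_1$ is a configuration $C'$ of g-2PATH (general at $p_0$) with $\mathrm{bc}_{C'}(p_l)=\mathrm{bc}_C(p_l)$ for $i\le l\le j$; $f(i,j)=\sup\{|x_0|:(x_0,x_1)\in W(i,j)\}$, $g(i,j)=\sup\{|x_1|:(x_0,x_1)\in W(i,j)\}$ (possibly $\infty$). The left hand of $C$ is free if $r=0$ or ($r<0$ and $f(r+1,s)=\infty$), and closed otherwise; the right hand is free if $s=0$ or ($s>0$ and $g(r,s-1)=\infty$), and closed otherwise. $C$ is of Type I if both hands are free. *)

theory Defs
  imports Main "HOL-Library.Extended_Nat"
begin

type_synonym pos = "int \<times> int"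

definition eps :: "nat \<Rightarrow> pos" where
  "eps i = (if i = 0 then (1,0) else if i = 1 then (0,1) else if i = 2 then (-1,0) else (0,-1))"

definition shift :: "pos \<Rightarrow> nat \<Rightarrow> pos" where
  "shift q i = (fst q + fst (eps i), snd q + snd (eps i))"

definition adj :: "pos \<Rightarrow> pos \<Rightarrow> bool" where
  "adj q q' \<longleftrightarrow> (\<exists>i<4. q' = shift q i)"

definition bc :: "pos set \<Rightarrow> pos \<Rightarrow> bool \<times> bool \<times> bool \<times> bool" where
  "bc S q = (shift q 0 \<in> S, shift q 1 \<in> S, shift q 2 \<in> S, shift q 3 \<in> S)"

text \<open>A list of positions with the general at list index k.\<close>
definition cfg_list :: "pos list \<Rightarrow> nat \<Rightarrow> bool" where
  "cfg_list xs k \<longleftrightarrow> k < length xs \<and> xs ! k = (0,0)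
     \<and> (\<forall>l. Suc l < length xs \<longrightarrow> adj (xs ! l) (xs ! Suc l))
     \<and> distinct xs
     \<and> (\<forall>l m. l < length xs \<and> m < length xs \<and> l + 2 \<le> m \<longrightarrow> \<not> adj (xs ! l) (xs ! m))"

text \<open>A configuration C = p_r ... p_s is given by r, s and p (only p on [r..s] matters).\<close>
definition is_config :: "int \<Rightarrow> int \<Rightarrow> (int \<Rightarrow> pos) \<Rightarrow> bool" where
  "is_config r s p \<longleftrightarrow> r \<le> 0 \<and> 0 \<le> s \<and> cfg_list (map p [r..s]) (nat (-r))"

definition cpos :: "int \<Rightarrow> int \<Rightarrow> (int \<Rightarrow> pos) \<Rightarrow> pos set" where
  "cpos r s p = p ` {r..s}"

definition W :: "int \<Rightarrow> int \<Rightarrow> (int \<Rightarrow> pos) \<Rightarrow> int \<Rightarrow> int \<Rightarrow> (pos list \<times> pos list) set" where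
  "W r s p i j = {(x0, x1). cfg_list (x0 @ map p [i..j] @ x1) (length x0 + nat (-i))
      \<and> (\<forall>l\<in>{i..j}. bc (set (x0 @ map p [i..j] @ x1)) (p l) = bc (cpos r s p) (p l))}"

definition fW :: "int \<Rightarrow> int \<Rightarrow> (int \<Rightarrow> pos) \<Rightarrow> int \<Rightarrow> int \<Rightarrow> enat" where
  "fW r s p i j = Sup ((\<lambda>(x0, x1). enat (length x0)) ` W r s p i j)"

definition gW :: "int \<Rightarrow> int \<Rightarrow> (int \<Rightarrow> pos) \<Rightarrow> int \<Rightarrow> int \<Rightarrow> enat" where
  "gW r s p i j = Sup ((\<lambda>(x0, x1). enat (length x1)) ` W r s p i j)"

definition left_free :: "int \<Rightarrow> int \<Rightarrow> (int \<Rightarrow> pos) \<Rightarrow> bool" where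
  "left_free r s p \<longleftrightarrow> r = 0 \<or> (r < 0 \<and> fW r s p (r + 1) s = \<infinity>)"

definition right_free :: "int \<Rightarrow> int \<Rightarrow> (int \<Rightarrow> pos) \<Rightarrow> bool" where
  "right_free r s p \<longleftrightarrow> s = 0 \<or> (s > 0 \<and> gW r s p r (s - 1) = \<infinity>)"

definition typeI :: "int \<Rightarrow> int \<Rightarrow> (int \<Rightarrow> pos) \<Rightarrow> bool" where
  "typeI r s p \<longleftrightarrow> left_free r s p \<and> right_free r s p"

record fsa =
  St :: "nat set"
  Qs :: nat
  Gen :: "nat \<Rightarrow> nat"
  mG :: nat
  Fire :: "nat set"
  tau :: "bool \<times> bool \<times> bool \<times> bool \<Rightarrow> nat"
  delta :: "nat \<Rightarrow> nat option \<Rightarrow> nat option \<Rightarrow> nat option \<Rightarrow> nat option \<Rightarrow> nat"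

definition valid_fsa :: "fsa \<Rightarrow> bool" where
  "valid_fsa A \<longleftrightarrow> finite (St A) \<and> Qs A \<in> St A
     \<and> (\<forall>i<mG A. Gen A i \<in> St A) \<and> Fire A \<subseteq> St A \<and> Qs A \<notin> Fire A
     \<and> (\<forall>b. tau A b < mG A)
     \<and> (\<forall>x a b c d. x \<in> St A \<and> set_option a \<subseteq> St A \<and> set_option b \<subseteq> St A
          \<and> set_option c \<subseteq> St A \<and> set_option d \<subseteq> St A \<longrightarrow> delta A x a b c d \<in> St A)
     \<and> (\<forall>a b c d. set_option a \<subseteq> {Qs A} \<and> set_option b \<subseteq> {Qs A}
          \<and> set_option c \<subseteq> {Qs A} \<and> set_option d \<subseteq> {Qs A} \<longrightarrow> delta A (Qs A) a b c d = Qs A)"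

text \<open>State of node v at time t when A runs on the configuration with position set N
  (None plays the role of the border symbol #).\<close>
fun run :: "fsa \<Rightarrow> pos set \<Rightarrow> nat \<Rightarrow> pos \<Rightarrow> nat" where
  "run A N 0 v = (if v = (0,0) then Gen A (tau A (bc N (0,0))) else Qs A)"
| "run A N (Suc t) v = delta A (run A N t v)
     (if shift v 0 \<in> N then Some (run A N t (shift v 0)) else None)
     (if shift v 1 \<in> N then Some (run A N t (shift v 1)) else None)
     (if shift v 2 \<in> N then Some (run A N t (shift v 2)) else None)
     (if shift v 3 \<in> N then Some (run A N t (shift v 3)) else None)"

definition fires_at :: "fsa \<Rightarrow> pos set \<Rightarrow> nat \<Rightarrow> bool" where
  "fires_at A N t \<longleftrightarrow> (\<forall>t'<t. \<forall>v\<in>N. run A N t' v \<notin> Fire A) \<and> (\<forall>v\<in>N. run A N t v \<in> Fire A)"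

definition solution :: "fsa \<Rightarrow> bool" where
  "solution A \<longleftrightarrow> valid_fsa A \<and>
     (\<forall>r s p. is_config r s p \<longrightarrow> (\<exists>t. fires_at A (cpos r s p) t))"

definition ft :: "int \<Rightarrow> int \<Rightarrow> (int \<Rightarrow> pos) \<Rightarrow> fsa \<Rightarrow> nat" where
  "ft r s p A = (LEAST t. fires_at A (cpos r s p) t)"

definition mft :: "int \<Rightarrow> int \<Rightarrow> (int \<Rightarrow> pos) \<Rightarrow> enat" where
  "mft r s p = Inf ((\<lambda>A. enat (ft r s p A)) ` {A. solution A})"

end

theory Submission
  imports Defs
begin

text \<open>
  Lower bound: let the right arm be the longer one (the other case is the mirror image). Replacing
  the end of the free right hand by a long tail is invisible to the last node before time \<open>s\<close>, and
  this difference needs \<open>s - r\<close> further steps to reach the opposite end. So before time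
  \<open>- r + s + s\<close> the opposite end cannot tell \<open>C\<close> from a configuration in which the firing squad
  signal has not even reached the far tail.

  Upper bound: the automaton may depend on the target time \<open>T\<close>. Until time \<open>T\<close> every awake node
  carries a clock and the set of known arm lengths, keyed by the direction of the arm at the
  general. At time \<open>T\<close> all nodes know both arms if the optimal time of the configuration is \<open>T\<close>, and
  then they fire; otherwise no node fires, the general restarts, and a slow firing squad takes over.

  The slow firing squad works in stages. Each node has a distance \<open>y \<le> m\<close> to the nearest general,
  and its state is a function of \<open>m\<close>, \<open>y\<close> and the time since the beginning of the stage. A wave of
  speed 1 leaves the generals, is reflected at distance \<open>m\<close>, and comes back after \<open>2m + 1\<close> steps,
  exactly when a wave of speed 1/2 reaches distance \<open>m\<close>. So the nodes at distance \<open>0\<close> and \<open>m\<close> become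
  generals simultaneously, the distance becomes \<open>min y (m - y)\<close>, and \<open>m\<close> is halved.
\<close>

subsection \<open>Automata over an arbitrary state type\<close>

definition dirs :: "pos set \<Rightarrow> pos \<Rightarrow> nat set" where
  "dirs N v = {i. i < 4 \<and> shift v i \<in> N}"

text \<open>Inputs are a set of pairs of a direction and a state; a missing direction plays the role
  of the border symbol, and \<open>dirs\<close> replaces the boundary vector.\<close>

fun arun :: "(nat set \<Rightarrow> 'a) \<Rightarrow> 'a \<Rightarrow> ('a \<Rightarrow> (nat \<times> 'a) set \<Rightarrow> 'a) \<Rightarrow> pos set \<Rightarrow> nat \<Rightarrow> pos \<Rightarrow> 'a" where
  "arun g q f N 0 v = (if v = (0,0) then g (dirs N (0,0)) else q)"
| "arun g q f N (Suc t) v =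
     f (arun g q f N t v) ((\<lambda>i. (i, arun g q f N t (shift v i))) ` dirs N v)"

fun bits :: "bool \<times> bool \<times> bool \<times> bool \<Rightarrow> nat set" where
  "bits (a, b, c, d) = {i. i < 4 \<and> [a, b, c, d] ! i}"

lemma less_4: "(i::nat) < 4 \<longleftrightarrow> i = 0 \<or> i = 1 \<or> i = 2 \<or> i = 3"
  by auto

lemma dirs_union: "dirs N v = (if shift v 0 \<in> N then {0} else {}) \<union> (if shift v 1 \<in> N then {1} else {})
    \<union> (if shift v 2 \<in> N then {2} else {}) \<union> (if shift v 3 \<in> N then {3} else {})"
  unfolding dirs_def less_4 by (rule set_eqI) (smt (verit) Un_iff empty_iff insert_iff mem_Collect_eq)

lemma bits_bc: "bits (bc N v) = dirs N v"
  by (auto simp: bc_def dirs_def less_4)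

text \<open>A finite \<open>S\<close> embeds into the naturals, and the 16 boundary vectors are
  numbered by a bijection \<open>h\<close> onto \<open>{i. i < m}\<close>. With
  \<open>tau = h\<close>, the index of a general state determines the boundary vector, so
  \<open>Gen\<close> can compute \<open>g\<close>.\<close>

lemma fsa_of_arun:
  assumes fin: "finite S" and q: "q \<in> S" "q \<notin> F" and F: "F \<subseteq> S"
    and g: "\<And>D. D \<subseteq> {..<4} \<Longrightarrow> g D \<in> S"
    and closed: "\<And>x Y. x \<in> S \<Longrightarrow> Y \<subseteq> {..<4} \<times> S \<Longrightarrow> f x Y \<in> S"
    and quiet: "\<And>Y. snd ` Y \<subseteq> {q} \<Longrightarrow> f q Y = q"
  obtains A where "valid_fsa A"
    "\<And>N t v. run A N t v \<in> Fire A \<longleftrightarrow> arun g q f N t v \<in> F"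
proof -
  obtain enc :: "'a \<Rightarrow> nat" and n where enc: "inj_on enc S"
    using finite_imp_inj_to_nat_seg[OF fin] by blast
  obtain h :: "bool \<times> bool \<times> bool \<times> bool \<Rightarrow> nat" and m where
    h: "h ` UNIV = {i. i < m}" "inj h"
    using finite_imp_inj_to_nat_seg[of "UNIV :: (bool \<times> bool \<times> bool \<times> bool) set"] by auto
  define dec where "dec = inv_into S enc"
  have dec: "dec (enc x) = x" if "x \<in> S" for x
    using that enc by (simp add: dec_def)
  define nb where "nb i a = (\<lambda>s. (i::nat, dec s)) ` set_option a" for i a
  define A where "A = \<lparr>St = enc ` S, Qs = enc q, Gen = (\<lambda>i. enc (g (bits (inv h i)))), mG = m,
     Fire = enc ` F, tau = h,
     delta = (\<lambda>x a b c d. enc (f (dec x) (nb 0 a \<union> nb 1 b \<union> nb 2 c \<union> nb 3 d)))\<rparr>"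
  have bits4: "bits b \<subseteq> {..<4}" for b
    by (cases b) auto
  have nb4: "nb i a \<subseteq> {..<4} \<times> S" if "i < 4" "set_option a \<subseteq> enc ` S" for i a
    using that by (auto simp: nb_def dec)
  have valid: "valid_fsa A"
    unfolding valid_fsa_def
  proof (intro conjI allI impI)
    show "finite (St A)" "Qs A \<in> St A" "Fire A \<subseteq> St A"
      using fin q F by (auto simp: A_def)
    show "Gen A i \<in> St A" for i
      using g[OF bits4] by (auto simp: A_def)
    show "Qs A \<notin> Fire A"
      using q F enc by (auto simp: A_def dest!: inj_onD)
    show "tau A b < mG A" for b
      using h(1) by (auto simp: A_def)
  next
    fix x a b c d
    assume "x \<in> St A \<and> set_option a \<subseteq> St A \<and> set_option b \<subseteq> St A
          \<and> set_option c \<subseteq> St A \<and> set_option d \<subseteq> St A"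
    then have "dec x \<in> S" "nb 0 a \<union> nb 1 b \<union> nb 2 c \<union> nb 3 d \<subseteq> {..<4} \<times> S"
      using nb4[of 0 a] nb4[of 1 b] nb4[of 2 c] nb4[of 3 d] by (auto simp: A_def dec)
    then show "delta A x a b c d \<in> St A"
      using closed by (auto simp: A_def)
  next
    fix a b c d
    assume "set_option a \<subseteq> {Qs A} \<and> set_option b \<subseteq> {Qs A}
          \<and> set_option c \<subseteq> {Qs A} \<and> set_option d \<subseteq> {Qs A}"
    then have "snd ` (nb 0 a \<union> nb 1 b \<union> nb 2 c \<union> nb 3 d) \<subseteq> {q}"
      using q dec by (auto simp: A_def nb_def)
    then show "delta A (Qs A) a b c d = Qs A"
      using quiet dec q by (simp add: A_def)
  qed
  \<comment> \<open>\<open>dec\<close> inverts \<open>enc\<close> only on \<open>S\<close>, so the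
    run has to stay in \<open>S\<close>.\<close>
  have inS: "arun g q f N t v \<in> S" for N t v
  proof (induction t arbitrary: v)
    case 0
    show ?case using g[of "dirs N (0,0)"] q by (auto simp: dirs_def)
  next
    case (Suc t)
    show ?case by (auto intro!: closed Suc simp: dirs_def)
  qed
  have run: "run A N t v = enc (arun g q f N t v)" for N t v
  proof (induction t arbitrary: v)
    case 0
    show ?case using h(2) by (simp add: A_def bits_bc)
  next
    case (Suc t)
    let ?n = "\<lambda>i. nb i (if shift v i \<in> N then Some (run A N t (shift v i)) else None)"
    have "(\<lambda>i. (i, arun g q f N t (shift v i))) ` dirs N v = ?n 0 \<union> ?n 1 \<union> ?n 2 \<union> ?n 3"
      by (simp add: dirs_union nb_def Suc dec[OF inS] image_Un del: One_nat_def)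
    moreover have "delta A (enc (arun g q f N t v)) a b c d =
        enc (f (arun g q f N t v) (nb 0 a \<union> nb 1 b \<union> nb 2 c \<union> nb 3 d))" for a b c d
      by (simp add: A_def dec[OF inS])
    ultimately show ?case
      by (simp only: run.simps arun.simps Suc)
  qed
  have "run A N t v \<in> Fire A \<longleftrightarrow> arun g q f N t v \<in> F" for N t v
  proof -
    have "Fire A = enc ` F" by (simp add: A_def)
    then show ?thesis
      unfolding run using inS F enc by (simp add: inj_on_image_mem_iff)
  qed
  with valid show thesis using that by blast
qed

subsection \<open>The automaton\<close>

text \<open>
  In \<open>Act s t K\<close>, \<open>t\<close> is the clock, \<open>s\<close> is the direction in which the arm of the node leaves the
  general (4 for the general itself), and \<open>K\<close> consists of pairs of a direction and an arm length.
  \<open>Src\<close> and \<open>Trav\<close> carry the general to an end of the path, where the slow firing squad starts;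
  \<open>Blk\<close> keeps this signal from turning back. In \<open>Cell c s\<close>, \<open>F1a\<close> and \<open>F2a\<close> are the fronts of the
  fast wave on its way out and back, \<open>F1b\<close> and \<open>F2b\<close> its trails; the front of the slow wave stays
  two steps at a node, as \<open>s = 1\<close> and \<open>s = 2\<close>.
\<close>

datatype fast = F1a | F1b | F2a | F2b | Mid

datatype st = Quiet | Fired | G0 | G1 | G2 | Cell fast nat | Src nat | Trav | Blk
  | Act nat nat "(nat \<times> nat) set"

text \<open>
  A direction in which the general has no neighbour counts as an arm of length 0, so that the four
  arm lengths of a configuration have sum \<open>s - r\<close> and maximum \<open>max (- r) s\<close>.
\<close>

definition crit :: "nat \<Rightarrow> (nat \<times> nat) set \<Rightarrow> bool" where
  "crit T K \<longleftrightarrow> fst ` K = {..<4} \<and> sum snd K + Max (snd ` K) = T"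

text \<open>A general with at most one neighbour is an end of the path and starts the slow firing
  squad itself. Otherwise either neighbour may be chosen; \<open>Src\<close> stores the direction
  because both neighbours see the same state.\<close>

definition start :: "nat set \<Rightarrow> st" where
  "start D = (if card D \<le> 1 then G0 else Src (SOME d. d \<in> D))"

definition finish :: "nat \<Rightarrow> nat \<Rightarrow> nat \<Rightarrow> (nat \<times> nat) set \<Rightarrow> nat set \<Rightarrow> st" where
  "finish T s t K D = (if t < T then Act s t K else if crit T K then Fired
     else if s = 4 then start D else Quiet)"

text \<open>Already the initial state goes through \<open>finish\<close>, which makes the one-node
  path fire at time 0 if \<open>T = 0\<close>.\<close>

definition gen :: "nat \<Rightarrow> nat set \<Rightarrow> st" where
  "gen T D = finish T 4 0 (({..<4} - D) \<times> {0}) D"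

fun facts :: "st \<Rightarrow> (nat \<times> nat) set" where
  "facts (Act s t K) = K"
| "facts _ = {}"

fun active :: "st \<Rightarrow> bool" where
  "active (Act s t K) = True"
| "active _ = False"

text \<open>Direction \<open>i\<close> points back to the waking neighbour, so its opposite is the
  direction of the arm if that neighbour is the general. A sleeping neighbour shows that the path
  goes on; without one the node is the end of its arm, and its waking time \<open>Suc t\<close> is
  the arm length.\<close>

fun wake :: "nat \<Rightarrow> nat \<times> st \<Rightarrow> st set \<Rightarrow> st" where
  "wake T (i, Act s t K) X = (let s' = (if s = 4 then (i + 2) mod 4 else s) in
     finish T s' (Suc t) (if Quiet \<in> X then K else insert (s', Suc t) K) {})"
| "wake T _ X = Quiet"

fun front :: "st \<Rightarrow> bool" where
  "front G0 = True"
| "front (Cell c s) = (c = F1a)"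
| "front _ = False"

fun returning :: "st \<Rightarrow> bool" where
  "returning (Cell c s) = (c = F2a \<or> c = Mid)"
| "returning _ = False"

fun slow2 :: "st \<Rightarrow> bool" where
  "slow2 G1 = True"
| "slow2 (Cell c s) = (s = 2)"
| "slow2 _ = False"

definition next_slow :: "st set \<Rightarrow> nat \<Rightarrow> nat" where
  "next_slow X s = (if s = 0 then (if \<exists>x\<in>X. slow2 x then 1 else 0) else if s < 3 then Suc s else 3)"

text \<open>A front without a sleeping neighbour has met another front or the end of the path. It
  turns into \<open>Mid\<close>, which marks the place of reflection and releases the returning
  wave.\<close>

fun next_fast :: "st set \<Rightarrow> fast \<Rightarrow> fast" where
  "next_fast X F1a = (if Quiet \<in> X then F1b else Mid)"
| "next_fast X F1b = (if \<exists>x\<in>X. returning x then F2a else F1b)"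
| "next_fast X F2a = F2b"
| "next_fast X F2b = F2b"
| "next_fast X Mid = Mid"

text \<open>A \<open>Src\<close> seen in direction \<open>i\<close> addresses this node exactly if
  it points the opposite way. \<open>Mid\<close> becomes a general one step after the slow wave
  arrives, and a \<open>Cell\<close> falls asleep when both waves have passed. A \<open>G0\<close>
  fires if it sees nothing but \<open>G0\<close>; this includes a node without neighbours.\<close>

definition step :: "nat \<Rightarrow> st \<Rightarrow> (nat \<times> st) set \<Rightarrow> st" where
  "step T x Y = (let X = snd ` Y in case x of
     Quiet \<Rightarrow>
       if \<exists>y\<in>X. active y then wake T (SOME y. y \<in> Y \<and> active (snd y)) X
       else if Trav \<in> X \<or> (\<exists>i. (i, Src ((i + 2) mod 4)) \<in> Y) then Trav
       else if \<exists>x\<in>X. front x then Cell F1a 0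
       else Quiet
   | Act s t K \<Rightarrow> finish T s (Suc t) (K \<union> \<Union> (facts ` X)) (fst ` Y)
   | Src d \<Rightarrow> Blk
   | Blk \<Rightarrow> Quiet
   | Trav \<Rightarrow> if Quiet \<in> X then Blk else G0
   | G0 \<Rightarrow> if X \<subseteq> {G0} then Fired else G1
   | G1 \<Rightarrow> G2
   | G2 \<Rightarrow> if \<exists>x\<in>X. returning x then G0 else G2
   | Cell c s \<Rightarrow>
       if c = Mid \<and> s \<ge> 1 then G0
       else if next_fast X c = F2b \<and> next_slow X s = 3 then Quiet
       else Cell (next_fast X c) (next_slow X s)
   | Fired \<Rightarrow> Fired)"

abbreviation srun :: "nat \<Rightarrow> pos set \<Rightarrow> nat \<Rightarrow> pos \<Rightarrow> st" where
  "srun T \<equiv> arun (gen T) Quiet (step T)"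

lemmas step_simps = step_def Let_def

section \<open>A finite set of states closed under the transition function\<close>

fun well_formed :: "nat \<Rightarrow> st \<Rightarrow> bool" where
  "well_formed T (Act s t K) \<longleftrightarrow> s \<le> 4 \<and> t < T \<and> K \<subseteq> {..4} \<times> {..T}"
| "well_formed T (Cell c s) \<longleftrightarrow> s \<le> 3"
| "well_formed T (Src d) \<longleftrightarrow> d < 4"
| "well_formed T _ \<longleftrightarrow> True"

definition states :: "nat \<Rightarrow> st set" where
  "states T = Collect (well_formed T)"

lemma finite_states: "finite (states T)"
proof (rule finite_subset)
  show "states T \<subseteq> {Quiet, Fired, G0, G1, G2, Trav, Blk} \<union> Src ` {..<4}
      \<union> (\<Union>c\<in>{F1a, F1b, F2a, F2b, Mid}. Cell c ` {..3})
      \<union> (\<lambda>(s, t, K). Act s t K) ` ({..4} \<times> {..<T} \<times> Pow ({..4} \<times> {..T}))"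
    (is "_ \<subseteq> ?U")
  proof
    fix x assume "x \<in> states T"
    then show "x \<in> ?U"
    proof (cases x)
      case (Cell c s)
      then show ?thesis using \<open>x \<in> states T\<close> by (cases c) (auto simp: states_def)
    next
      case (Act s t K)
      then show ?thesis
        using \<open>x \<in> states T\<close> by (intro UnI2 image_eqI[of _ _ "(s, t, K)"]) (auto simp: states_def)
    qed (auto simp: states_def)
  qed
qed auto

lemma start_states:
  assumes "D \<subseteq> {..<4}"
  shows "start D \<in> states T"
proof (cases "card D \<le> 1")
  case False
  then have "D \<noteq> {}" by auto
  then have "(SOME d. d \<in> D) \<in> D" by (rule some_in_eq[THEN iffD2])
  then have "(SOME d. d \<in> D) < 4" using assms by auto
  then show ?thesis using False by (simp add: start_def states_def)
qed (simp add: start_def states_def)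

lemma finish_states:
  assumes "s \<le> 4" "K \<subseteq> {..4} \<times> {..T}" "D \<subseteq> {..<4}"
  shows "finish T s t K D \<in> states T"
  using assms start_states[of D T]
  by (auto simp: finish_def states_def)

lemma facts_states: "y \<in> states T \<Longrightarrow> facts y \<subseteq> {..4} \<times> {..T}"
  by (cases y) (auto simp: states_def)

lemma wake_states:
  assumes "y \<in> {..<4} \<times> states T"
  shows "wake T y X \<in> states T"
proof (cases "active (snd y)")
  case True
  then obtain i s t K where y: "y = (i, Act s t K)"
    by (cases y; cases "snd y") auto
  define s' where "s' = (if s = 4 then (i + 2) mod 4 else s)"
  have "s' \<le> 4" "K \<subseteq> {..4} \<times> {..T}" "Suc t \<le> T"
    using assms by (auto simp: s'_def y states_def intro: less_imp_le)
  then show ?thesis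
    by (simp add: y s'_def[symmetric] finish_states)
next
  case False
  then have "wake T y X = Quiet" by (cases y; cases "snd y") auto
  then show ?thesis by (simp add: states_def)
qed

lemma some_active:
  assumes "\<exists>y\<in>snd ` Y. active y"
  shows "(SOME y. y \<in> Y \<and> active (snd y)) \<in> Y" "active (snd (SOME y. y \<in> Y \<and> active (snd y)))"
proof -
  obtain y where "y \<in> Y \<and> active (snd y)" using assms by auto
  then have "(SOME y. y \<in> Y \<and> active (snd y)) \<in> Y \<and> active (snd (SOME y. y \<in> Y \<and> active (snd y)))"
    by (rule someI)
  then show "(SOME y. y \<in> Y \<and> active (snd y)) \<in> Y" "active (snd (SOME y. y \<in> Y \<and> active (snd y)))"
    by blast+
qed

lemma next_slow_le: "next_slow X s \<le> 3"
  by (auto simp: next_slow_def)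

lemma step_states:
  assumes "x \<in> states T" "Y \<subseteq> {..<4} \<times> states T"
  shows "step T x Y \<in> states T"
proof (cases x)
  case Quiet
  have "wake T (SOME y. y \<in> Y \<and> active (snd y)) X \<in> states T" if "\<exists>y\<in>snd ` Y. active y" for X
    using some_active(1)[OF that] assms(2) by (intro wake_states) auto
  then show ?thesis by (simp add: Quiet step_simps) (simp add: states_def)
next
  case (Act s t K)
  have "\<Union> (facts ` snd ` Y) \<subseteq> {..4} \<times> {..T}"
    using assms(2) facts_states[of _ T] by fastforce
  moreover have "fst ` Y \<subseteq> {..<4}" using assms(2) by auto
  ultimately have "finish T s (Suc t) (K \<union> \<Union> (facts ` snd ` Y)) (fst ` Y) \<in> states T"
    using assms(1) by (intro finish_states) (simp_all add: states_def Act)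
  then show ?thesis by (simp add: Act step_simps)
qed (simp_all add: step_simps states_def next_slow_le)

lemma gen_states: "D \<subseteq> {..<4} \<Longrightarrow> gen T D \<in> states T"
  by (auto simp: gen_def intro!: finish_states)

lemma step_quiet:
  assumes "snd ` Y \<subseteq> {Quiet}"
  shows "step T Quiet Y = Quiet"
proof -
  have "x = Quiet" if "x \<in> snd ` Y" for x
    using assms that by blast
  moreover have "(i, Src d) \<notin> Y" for i d
    using assms by (metis image_eqI singletonD snd_conv st.distinct subsetD)
  ultimately have "\<not> (\<exists>y\<in>snd ` Y. active y)" "Trav \<notin> snd ` Y" "\<not> (\<exists>i. (i, Src ((i + 2) mod 4)) \<in> Y)"
    "\<not> (\<exists>x\<in>snd ` Y. front x)"
    by force+
  then show ?thesis
    by (simp add: step_simps)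
qed

subsection \<open>One stage of the slow firing squad\<close>

definition slow_phase :: "nat \<Rightarrow> nat \<Rightarrow> nat" where
  "slow_phase y t = (if t < 2 * y then 0 else if t = 2 * y then 1 else if t = 2 * y + 1 then 2 else 3)"

text \<open>The outgoing front is at distance \<open>y\<close> at time \<open>y\<close>, the
  returning one at time \<open>2 * m + 1 - y\<close>; the extra step is spent on the reflection at
  distance \<open>m\<close>.\<close>

definition fast_phase :: "nat \<Rightarrow> nat \<Rightarrow> nat \<Rightarrow> fast" where
  "fast_phase m y t = (if t = y then F1a else if t + y \<le> 2 * m then F1b
     else if t + y = 2 * m + 1 then F2a else F2b)"

text \<open>A cell forgets the waves once both have left it. So at time \<open>2 * m + 1\<close>
  only generals and sleeping nodes remain, and the next stage can begin.\<close>

definition stage :: "nat \<Rightarrow> nat \<Rightarrow> nat \<Rightarrow> st" where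
  "stage m t y =
    (if y = 0 then (if t = 0 \<or> t = 2 * m + 1 then G0 else if t = 1 then G1 else G2)
     else if t < y then Quiet
     else if y = m then
       (if t = m then Cell F1a 0 else if t \<le> 2 * m then Cell Mid (slow_phase y t) else G0)
     else if t + y > 2 * m + 1 \<and> t > 2 * y + 1 then Quiet
     else Cell (fast_phase m y t) (slow_phase y t))"

lemmas stage_defs = stage_def fast_phase_def slow_phase_def

lemma stage_quiet:
  "stage m t z = Quiet \<longleftrightarrow> 0 < z \<and> (t < z \<or> z \<noteq> m \<and> t + z > 2 * m + 1 \<and> t > 2 * z + 1)"
  by (auto simp: stage_defs)

lemma stage_front:
  assumes "z \<le> m" "t \<le> 2 * m"
  shows "front (stage m t z) \<longleftrightarrow> t = z"
  using assms by (auto simp: stage_defs)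

lemma stage_returning:
  assumes "z \<le> m"
  shows "returning (stage m t z) \<longleftrightarrow>
    0 < z \<and> (if z = m then m < t \<and> t \<le> 2 * m else t + z = 2 * m + 1)"
  using assms by (auto simp: stage_defs)

lemma stage_slow2:
  assumes "z \<le> m" "0 < m"
  shows "slow2 (stage m t z) \<longleftrightarrow> z < m \<and> t = 2 * z + 1"
  using assms by (auto simp: stage_defs)

lemma stage_other: "\<not> active (stage m t z)" "stage m t z \<noteq> Trav" "stage m t z \<noteq> Src d"
  by (auto simp: stage_defs)

lemma step_Quiet:
  assumes "\<And>x. x \<in> snd ` Y \<Longrightarrow> \<not> active x" "Trav \<notin> snd ` Y" "\<And>d. Src d \<notin> snd ` Y"
  shows "step T Quiet Y = (if \<exists>x\<in>snd ` Y. front x then Cell F1a 0 else Quiet)"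
proof -
  have "\<not> (\<exists>y\<in>snd ` Y. active y)" "\<not> (\<exists>i. (i, Src ((i + 2) mod 4)) \<in> Y)"
    using assms by force+
  with assms(2) show ?thesis by (simp add: step_simps)
qed

text \<open>In a stage a node reacts only to which states occur among its neighbours, and these
  depend on the distances alone. So the set \<open>Z\<close> of the neighbouring distances
  suffices.\<close>

lemma stage_step:
  assumes m: "0 < m" and t: "t \<le> 2 * m" and y: "y \<le> m"
    and Y: "snd ` Y = stage m t ` Z"
    and Z0: "y = 0 \<Longrightarrow> 1 \<in> Z \<and> Z \<subseteq> {0, 1}"
    and Z1: "0 < y \<Longrightarrow> y < m \<Longrightarrow> Z = {y - 1, y + 1}"
    and Zm: "y = m \<Longrightarrow> m - 1 \<in> Z \<and> Z \<subseteq> {m - 1, m}"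
  shows "step T (stage m t y) Y = stage m (Suc t) y"
proof -
  have Zle: "z \<le> m" if "z \<in> Z" for z
    using that Z0 Z1 Zm y m by (cases "y = 0"; cases "y = m") force+
  define X where "X = snd ` Y"
  have front: "(\<exists>x\<in>X. front x) \<longleftrightarrow> t \<in> Z"
    using stage_front[OF Zle t] unfolding X_def Y by auto
  have ret: "(\<exists>x\<in>X. returning x) \<longleftrightarrow>
      (\<exists>z\<in>Z. 0 < z \<and> (if z = m then m < t \<and> t \<le> 2 * m else t + z = 2 * m + 1))"
    using stage_returning[OF Zle] unfolding X_def Y by (simp cong: bex_cong)
  have slow: "(\<exists>x\<in>X. slow2 x) \<longleftrightarrow> (\<exists>z\<in>Z. z < m \<and> t = 2 * z + 1)"
    using stage_slow2[OF Zle m] unfolding X_def Y by (simp cong: bex_cong)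
  have quiet: "Quiet \<in> X \<longleftrightarrow> (\<exists>z\<in>Z. 0 < z \<and> (t < z \<or> z \<noteq> m \<and> t + z > 2 * m + 1 \<and> t > 2 * z + 1))"
    unfolding stage_quiet[symmetric] X_def Y by (metis imageE imageI)
  have Q: "step T Quiet Y = (if t \<in> Z then Cell F1a 0 else Quiet)"
  proof (subst step_Quiet)
    show "\<not> active x" if "x \<in> snd ` Y" for x
      using that stage_other(1) unfolding Y by blast
    show "Trav \<notin> snd ` Y" "Src d \<notin> snd ` Y" for d
      using stage_other(2,3) unfolding Y by (metis imageE)+
  qed (simp add: front flip: X_def)
  consider "y = 0" | "0 < y" "y < m" | "0 < y" "y = m"
    using y m by linarith
  then show ?thesis
  proof cases
    case 1
    \<comment> \<open>A stage with \<open>0 < m\<close> must not fire at its start: every general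
      sees a sleeping node at distance 1.\<close>
    have X0: "\<not> X \<subseteq> {G0}" if "t = 0"
    proof -
      have "stage m 0 1 \<in> X" using Z0[OF 1] that unfolding X_def Y by blast
      moreover have "stage m 0 1 = Quiet" using m by (simp add: stage_def)
      ultimately show ?thesis by auto
    qed
    have re: "(\<exists>x\<in>X. returning x) \<longleftrightarrow> t = 2 * m" if "t \<ge> 2"
    proof -
      have "(\<exists>x\<in>X. returning x) \<longleftrightarrow> (if 1 = m then m < t \<and> t \<le> 2 * m else t + 1 = 2 * m + 1)"
        unfolding ret using Z0[OF 1] by auto
      then show ?thesis using that t by auto
    qed
    consider "t = 0" | "t = 1" | "t \<ge> 2" by linarith
    then show ?thesis
    proof cases
      case 1
      with X0 \<open>y = 0\<close> m show ?thesis by (simp add: stage_def step_simps flip: X_def)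
    next
      case 2
      with \<open>y = 0\<close> m show ?thesis by (simp add: stage_def step_simps)
    next
      case 3
      with re \<open>y = 0\<close> t show ?thesis by (simp add: stage_def step_simps flip: X_def)
    qed
  next
    case 2
    note Z = Z1[OF 2]
    have Zt: "t \<in> Z \<longleftrightarrow> t + 1 = y \<or> t = y + 1" using Z 2 by auto
    have qi: "Quiet \<in> X" if "t = y" unfolding quiet Z using that by auto
    have re: "(\<exists>x\<in>X. returning x) \<longleftrightarrow> t + y = 2 * m" if "y < t" "t + y \<le> 2 * m"
      unfolding ret Z using that 2 by auto
    have sl: "(\<exists>x\<in>X. slow2 x) \<longleftrightarrow> t + 1 = 2 * y" if "t < 2 * y"
      unfolding slow Z using that 2 by auto
    have ns: "next_slow X (slow_phase y t) = slow_phase y (Suc t)"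
      using sl 2 by (auto simp: next_slow_def slow_phase_def)
    have nf: "next_fast X (fast_phase m y t) = fast_phase m y (Suc t)" if "y \<le> t"
      using qi re 2 that by (auto simp: fast_phase_def)
    have fp: "fast_phase m y t \<noteq> Mid" "fast_phase m y (Suc t) = F2b \<longleftrightarrow> t + y \<ge> 2 * m + 1 \<and> y \<noteq> Suc t"
      "slow_phase y (Suc t) = 3 \<longleftrightarrow> t > 2 * y"
      by (auto simp: fast_phase_def slow_phase_def)
    consider "t < y" | "t + y > 2 * m + 1 \<and> t > 2 * y + 1"
      | "y \<le> t" "\<not> (t + y > 2 * m + 1 \<and> t > 2 * y + 1)" by linarith
    then show ?thesis
    proof cases
      case 3
      then have "stage m t y = Cell (fast_phase m y t) (slow_phase y t)"
        using 2 by (simp add: stage_def)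
      then have "step T (stage m t y) Y = (if t + y \<ge> 2 * m + 1 \<and> t > 2 * y then Quiet
          else Cell (fast_phase m y (Suc t)) (slow_phase y (Suc t)))"
        using 3 fp by (simp add: step_simps X_def[symmetric] nf ns)
      then show ?thesis
        using 2 3 by (auto simp: stage_def)
    qed (use 2 Q Zt in \<open>auto simp: stage_defs\<close>)
  next
    case 3
    note Z = Zm[OF 3(2)]
    \<comment> \<open>At time \<open>m\<close> the nodes at distance \<open>m - 1\<close> and
      \<open>m\<close> are awake, which is how a node at distance \<open>m\<close> recognises the
      place of reflection.\<close>
    have qi: "Quiet \<notin> X" if "t = m" unfolding quiet using that Z by auto
    have sl: "(\<exists>x\<in>X. slow2 x) \<longleftrightarrow> t + 1 = 2 * m"
      unfolding slow using Z m by (auto intro!: bexI[of _ "m - 1"])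
    consider "t < m" | "t = m" | "m < t" by linarith
    then show ?thesis
    proof cases
      case 1
      then have "t \<in> Z \<longleftrightarrow> Suc t = m" using Z by auto
      then show ?thesis using 1 3 Q by (auto simp: stage_defs)
    next
      case 2
      then show ?thesis using m 3 qi sl
        by (auto simp: stage_defs step_simps X_def[symmetric] next_slow_def)
    next
      case t': 3
      then show ?thesis using m 3 sl t
        by (auto simp: stage_defs step_simps X_def[symmetric] next_slow_def)
    qed
  qed
qed

subsection \<open>Halving the distance\<close>

text \<open>Equal neighbouring distances are allowed at 0 and at \<open>m\<close>: halving an odd
  \<open>m\<close> gives two adjacent nodes in the middle, which later become adjacent
  generals.\<close>

definition layered :: "pos set \<Rightarrow> (pos \<Rightarrow> nat) \<Rightarrow> nat \<Rightarrow> bool" where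
  "layered N D m \<longleftrightarrow> (\<forall>v\<in>N. D v \<le> m \<and> (0 < m \<longrightarrow>
     (let Z = (\<lambda>i. D (shift v i)) ` dirs N v in
       (D v = 0 \<longrightarrow> 1 \<in> Z \<and> Z \<subseteq> {0, 1}) \<and>
       (0 < D v \<and> D v < m \<longrightarrow> Z = {D v - 1, D v + 1}) \<and>
       (D v = m \<longrightarrow> m - 1 \<in> Z \<and> Z \<subseteq> {m - 1, m}))))"

text \<open>The interval \<open>[0, m]\<close> is folded at its middle. If \<open>m\<close> is odd,
  the two middle values both become \<open>m div 2\<close>, which produces neighbours of equal
  distance; equal neighbours at distance \<open>m\<close> turn into equal neighbours at 0.\<close>

lemma layered_fold:
  assumes "layered N D m" "0 < m"
  shows "layered N (\<lambda>v. min (D v) (m - D v)) (m div 2)"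
  unfolding layered_def
proof (intro ballI conjI impI)
  fix v assume "v \<in> N"
  define h where "h y = min y (m - y)" for y
  define Z where "Z = (\<lambda>i. D (shift v i)) ` dirs N v"
  have D: "D v \<le> m" and Z0: "D v = 0 \<Longrightarrow> 1 \<in> Z \<and> Z \<subseteq> {0, 1}"
    and Z1: "0 < D v \<Longrightarrow> D v < m \<Longrightarrow> Z = {D v - 1, D v + 1}"
    and Zm: "D v = m \<Longrightarrow> m - 1 \<in> Z \<and> Z \<subseteq> {m - 1, m}"
    using assms \<open>v \<in> N\<close> by (auto simp: layered_def Let_def Z_def)
  show "min (D v) (m - D v) \<le> m div 2" by simp
  assume m: "0 < m div 2"
  have hZ: "(\<lambda>i. min (D (shift v i)) (m - D (shift v i))) ` dirs N v = h ` Z"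
    by (simp add: Z_def h_def image_image)
  have hv: "min (D v) (m - D v) = h (D v)" by (simp add: h_def)
  have "(h (D v) = 0 \<longrightarrow> 1 \<in> h ` Z \<and> h ` Z \<subseteq> {0, 1}) \<and>
       (0 < h (D v) \<and> h (D v) < m div 2 \<longrightarrow> h ` Z = {h (D v) - 1, h (D v) + 1}) \<and>
       (h (D v) = m div 2 \<longrightarrow> m div 2 - 1 \<in> h ` Z \<and> h ` Z \<subseteq> {m div 2 - 1, m div 2})"
  proof -
    consider "D v = 0" | "0 < D v" "D v < m" | "D v = m" using D by linarith
    then show ?thesis
    proof cases
      case 1
      then have "1 \<in> Z" "Z \<subseteq> {0, 1}" using Z0 by auto
      then have "h 1 \<in> h ` Z" "h ` Z \<subseteq> {h 0, h 1}" by auto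
      moreover have "h 1 = 1" "h 0 = 0" using m by (auto simp: h_def)
      ultimately show ?thesis using 1 m by auto
    next
      case 2
      define y where "y = D v"
      have y: "0 < y" "y < m" and hZ: "h ` Z = {h (y - 1), h (y + 1)}"
        using 2 Z1 by (auto simp: y_def)
      consider "2 * y + 2 \<le> m" | "2 * y + 1 = m" | "2 * y = m" | "2 * y = m + 1" | "2 * y \<ge> m + 2"
        by linarith
      then show ?thesis
      proof cases
        case 1
        then have "h y = y" "h (y - 1) = y - 1" "h (y + 1) = y + 1" by (auto simp: h_def)
        moreover have "y < m div 2" using 1 by linarith
        ultimately show ?thesis unfolding y_def[symmetric] hZ using y by simp
      next
        case 2
        then have "h y = y" "h (y - 1) = y - 1" "h (y + 1) = y" "y = m div 2" by (auto simp: h_def)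
        then show ?thesis unfolding y_def[symmetric] hZ using y by simp
      next
        case 3
        then have "h y = y" "h (y - 1) = y - 1" "h (y + 1) = y - 1" "y = m div 2" by (auto simp: h_def)
        then show ?thesis unfolding y_def[symmetric] hZ using y by simp
      next
        case 4
        then have "h y = m div 2" "h (y - 1) = m div 2" "h (y + 1) = m div 2 - 1"
          by (auto simp: h_def)
        moreover have "m div 2 \<noteq> 0" using m by linarith
        ultimately show ?thesis unfolding y_def[symmetric] hZ by simp
      next
        case 5
        then have "h y = m - y" "h (y - 1) = m - y + 1" "h (y + 1) = m - y - 1" using y by (auto simp: h_def)
        moreover have "m - y < m div 2" using 5 y by linarith
        ultimately show ?thesis unfolding y_def[symmetric] hZ using y by auto
      qed
    next
      case 3
      then have "m - 1 \<in> Z" "Z \<subseteq> {m - 1, m}" using Zm by auto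
      then have "h (m - 1) \<in> h ` Z" "h ` Z \<subseteq> {h m, h (m - 1)}" by auto
      moreover have "h m = 0" "h (m - 1) = 1" using m by (auto simp: h_def)
      ultimately show ?thesis using 3 m by auto
    qed
  qed
  then show "let Z = (\<lambda>i. min (D (shift v i)) (m - D (shift v i))) ` dirs N v in
       (min (D v) (m - D v) = 0 \<longrightarrow> 1 \<in> Z \<and> Z \<subseteq> {0, 1}) \<and>
       (0 < min (D v) (m - D v) \<and> min (D v) (m - D v) < m div 2 \<longrightarrow>
         Z = {min (D v) (m - D v) - 1, min (D v) (m - D v) + 1}) \<and>
       (min (D v) (m - D v) = m div 2 \<longrightarrow> m div 2 - 1 \<in> Z \<and> Z \<subseteq> {m div 2 - 1, m div 2})"
    unfolding hZ hv Let_def .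
qed

lemma stage_run:
  assumes lay: "layered N D m" and m: "0 < m"
    and init: "\<And>v. v \<in> N \<Longrightarrow> srun T N t0 v = stage m 0 (D v)"
    and "t \<le> 2 * m + 1" "v \<in> N"
  shows "srun T N (t0 + t) v = stage m t (D v)"
  using assms(4,5)
proof (induction t arbitrary: v)
  case 0
  then show ?case using init by simp
next
  case (Suc t)
  let ?Z = "(\<lambda>i. D (shift v i)) ` dirs N v"
  let ?Y = "(\<lambda>i. (i, srun T N (t0 + t) (shift v i))) ` dirs N v"
  have "snd ` ?Y = stage m t ` ?Z"
    unfolding image_image snd_conv
    by (rule image_cong) (use Suc in \<open>auto simp: dirs_def\<close>)
  moreover have "D v \<le> m" "D v = 0 \<Longrightarrow> 1 \<in> ?Z \<and> ?Z \<subseteq> {0, 1}"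
    "0 < D v \<Longrightarrow> D v < m \<Longrightarrow> ?Z = {D v - 1, D v + 1}"
    "D v = m \<Longrightarrow> m - 1 \<in> ?Z \<and> ?Z \<subseteq> {m - 1, m}"
    using lay m Suc.prems by (auto simp: layered_def Let_def)
  ultimately have "step T (stage m t (D v)) ?Y = stage m (Suc t) (D v)"
    using m Suc.prems by (intro stage_step) auto
  then show ?case using Suc by simp
qed

definition fires_from :: "nat \<Rightarrow> pos set \<Rightarrow> nat \<Rightarrow> bool" where
  "fires_from T N t0 \<longleftrightarrow> (\<exists>t1\<ge>t0. (\<forall>t v. t0 \<le> t \<and> t < t1 \<and> v \<in> N \<longrightarrow> srun T N t v \<noteq> Fired)
     \<and> (\<forall>v\<in>N. srun T N t1 v = Fired))"

lemma fires_from_later: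
  assumes "fires_from T N (t0 + u)" "\<And>t v. t < u \<Longrightarrow> v \<in> N \<Longrightarrow> srun T N (t0 + t) v \<noteq> Fired"
  shows "fires_from T N t0"
proof -
  obtain t1 where t1: "t1 \<ge> t0 + u" "\<forall>v\<in>N. srun T N t1 v = Fired"
    "\<And>t v. t0 + u \<le> t \<Longrightarrow> t < t1 \<Longrightarrow> v \<in> N \<Longrightarrow> srun T N t v \<noteq> Fired"
    using assms(1) unfolding fires_from_def by blast
  have "srun T N t v \<noteq> Fired" if "t0 \<le> t" "t < t1" "v \<in> N" for t v
    using that assms(2)[of "t - t0" v] t1(3)[of t v] by (cases "t < t0 + u") auto
  with t1(1,2) show ?thesis unfolding fires_from_def by (intro exI[of _ t1]) auto
qed

text \<open>Every stage halves \<open>m\<close> and contains no \<open>Fired\<close>. At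
  \<open>m = 0\<close> all nodes are \<open>G0\<close>, so they see nothing else and fire in the
  next step.\<close>

lemma layered_fires:
  assumes "layered N D m" "\<And>v. v \<in> N \<Longrightarrow> srun T N t0 v = stage m 0 (D v)"
  shows "fires_from T N t0"
  using assms
proof (induction m arbitrary: t0 D rule: less_induct)
  case (less m)
  note lay = less.prems(1) and init = less.prems(2)
  show ?case
  proof (cases "m = 0")
    case True
    have G: "srun T N t0 v = G0" if "v \<in> N" for v
      using that lay init[OF that] True by (auto simp: layered_def stage_def)
    have "srun T N (Suc t0) v = Fired" if "v \<in> N" for v
      using that G by (auto simp: step_simps dirs_def)
    moreover have "t0 = t" if "t0 \<le> t" "t < Suc t0" for t using that by simp
    ultimately show ?thesis
      unfolding fires_from_def using G by (intro exI[of _ "Suc t0"]) (auto simp: less_Suc_eq_le dest!: le_antisym)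
  next
    case False
    note run = stage_run[OF lay _ init]
    have "stage m (2 * m + 1) y = stage (m div 2) 0 (min y (m - y))" if "y \<le> m" for y
      using that False by (auto simp: stage_def)
    then have "srun T N (t0 + (2 * m + 1)) v = stage (m div 2) 0 (min (D v) (m - D v))"
      if "v \<in> N" for v
      using that run[of "2 * m + 1" v] False lay by (simp add: layered_def)
    then have "fires_from T N (t0 + (2 * m + 1))"
      using False lay by (intro less.IH[of "m div 2" "\<lambda>v. min (D v) (m - D v)"] layered_fold) auto
    moreover have "srun T N (t0 + t) v \<noteq> Fired" if "t < 2 * m + 1" "v \<in> N" for t v
      using that run[of t v] False by (simp add: stage_def)
    ultimately show ?thesis
      by (rule fires_from_later)
  qed
qed

subsection \<open>Paths\<close>

lemma step_inert:
  assumes "snd ` Y \<subseteq> {Blk, Quiet}"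
  shows "step T Quiet Y = Quiet"
proof -
  have "x = Blk \<or> x = Quiet" if "x \<in> snd ` Y" for x
    using assms that by blast
  then have *: "\<not> active x" "x \<noteq> Trav" "x \<noteq> Src d" "\<not> front x" if "x \<in> snd ` Y" for x d
    using that by fastforce+
  have "step T Quiet Y = (if \<exists>x\<in>snd ` Y. front x then Cell F1a 0 else Quiet)"
    by (rule step_Quiet) (use * in blast)+
  then show ?thesis using *(4) by simp
qed

lemma shift_opposite: "d < 4 \<Longrightarrow> shift (shift v d) ((d + 2) mod 4) = v"
  by (auto simp: less_4 shift_def eps_def)

lemma opposite_less: "(d + 2) mod 4 < (4::nat)"
  by simp

lemma shift_inj: "d < 4 \<Longrightarrow> e < 4 \<Longrightarrow> shift v d = shift v e \<Longrightarrow> d = e"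
  by (auto simp: less_4 shift_def eps_def)

lemma adj_sym: "adj v w \<longleftrightarrow> adj w v"
  unfolding adj_def by (metis shift_opposite opposite_less)

lemma not_adj_self: "\<not> adj v v"
  by (auto simp: adj_def less_4 shift_def eps_def prod_eq_iff)

text \<open>Reversal exchanges the two hands, so later proofs need to treat only signals towards
  index 0 and free right hands.\<close>

lemma cfg_list_rev:
  assumes "cfg_list xs k"
  shows "cfg_list (rev xs) (length xs - 1 - k)"
  unfolding cfg_list_def
proof (intro conjI allI impI)
  let ?n = "length xs"
  have k: "k < ?n" "xs ! k = (0, 0)" and "distinct xs"
    and suc: "\<And>l. Suc l < ?n \<Longrightarrow> adj (xs ! l) (xs ! Suc l)"
    and far: "\<And>l m. m < ?n \<Longrightarrow> l + 2 \<le> m \<Longrightarrow> \<not> adj (xs ! l) (xs ! m)"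
    using assms by (auto simp: cfg_list_def)
  show "?n - 1 - k < length (rev xs)" using k by auto
  have "?n - Suc (?n - 1 - k) = k" "?n - 1 - k < ?n" using k by linarith+
  then show "rev xs ! (?n - 1 - k) = (0, 0)" using k by (simp only: rev_nth)
  show "distinct (rev xs)" using \<open>distinct xs\<close> by simp
  show "adj (rev xs ! l) (rev xs ! Suc l)" if "Suc l < length (rev xs)" for l
  proof -
    have "Suc (?n - Suc (Suc l)) = ?n - Suc l" using that by auto
    then have "adj (xs ! (?n - Suc (Suc l))) (xs ! (?n - Suc l))"
      using suc[of "?n - Suc (Suc l)"] that by simp
    then show ?thesis using that by (subst adj_sym) (simp add: rev_nth)
  qed
  show "\<not> adj (rev xs ! l) (rev xs ! m)"
    if "l < length (rev xs) \<and> m < length (rev xs) \<and> l + 2 \<le> m" for l m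
  proof -
    have "\<not> adj (xs ! (?n - Suc m)) (xs ! (?n - Suc l))"
      using that by (intro far) auto
    then show ?thesis using that by (subst adj_sym) (simp add: rev_nth)
  qed
qed

locale path =
  fixes xs :: "pos list" and k :: nat
  assumes cfg: "cfg_list xs k"
begin

abbreviation n :: nat where "n \<equiv> length xs"
abbreviation N :: "pos set" where "N \<equiv> set xs"

definition nbi :: "nat \<Rightarrow> nat set" where
  "nbi i = {j. j < n \<and> (Suc j = i \<or> j = Suc i)}"

definition dr :: "nat \<Rightarrow> nat \<Rightarrow> nat" where
  "dr i j = (SOME d. d < 4 \<and> shift (xs ! i) d = xs ! j)"

lemma k: "k < n" "xs ! k = (0, 0)"
  using cfg by (auto simp: cfg_list_def)

lemma nth_eq: "i < n \<Longrightarrow> j < n \<Longrightarrow> xs ! i = xs ! j \<longleftrightarrow> i = j"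
  using cfg by (auto simp: cfg_list_def nth_eq_iff_index_eq)

text \<open>Nodes far apart in the list are never adjacent, so the neighbours in the plane are
  exactly those in the list, and runs can be computed on indices.\<close>

lemma adj_iff:
  assumes "i < n" "j < n"
  shows "adj (xs ! i) (xs ! j) \<longleftrightarrow> j \<in> nbi i"
proof -
  have suc: "adj (xs ! l) (xs ! Suc l)" if "Suc l < n" for l
    using cfg that by (auto simp: cfg_list_def)
  have far: "\<not> adj (xs ! l) (xs ! m)" if "m < n" "l + 2 \<le> m" for l m
    using cfg that by (auto simp: cfg_list_def)
  consider "j = i" | "j = Suc i" | "i = Suc j" | "i + 2 \<le> j" | "j + 2 \<le> i" by linarith
  then show ?thesis
  proof cases
    case 4
    then show ?thesis using far[OF assms(2) 4] by (simp add: nbi_def)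
  next
    case 5
    then show ?thesis using far[OF assms(1) 5] by (simp add: nbi_def adj_sym[of "xs ! i"])
  next
    case 3
    then show ?thesis using suc[of j] assms by (subst adj_sym) (simp add: nbi_def)
  qed (use assms suc not_adj_self in \<open>auto simp: nbi_def\<close>)
qed

lemma dr:
  assumes "i < n" "j \<in> nbi i"
  shows "dr i j < 4" "shift (xs ! i) (dr i j) = xs ! j"
proof -
  have "\<exists>d. d < 4 \<and> shift (xs ! i) d = xs ! j"
    using adj_iff[of i j] assms by (auto simp: adj_def nbi_def)
  then have "dr i j < 4 \<and> shift (xs ! i) (dr i j) = xs ! j"
    unfolding dr_def by (rule someI_ex)
  then show "dr i j < 4" "shift (xs ! i) (dr i j) = xs ! j" by auto
qed

lemma nbi_less: "j \<in> nbi i \<Longrightarrow> j < n"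
  by (simp add: nbi_def)

lemma dr_unique:
  assumes "i < n" "j < n" "d < 4" "shift (xs ! i) d = xs ! j"
  shows "j \<in> nbi i" "dr i j = d"
proof -
  show j: "j \<in> nbi i" using adj_iff[of i j] assms by (auto simp: adj_def)
  show "dr i j = d" using dr[OF assms(1) j] assms(3,4) by (intro shift_inj[of _ _ "xs ! i"]) auto
qed

lemma dr_opposite:
  assumes "i < n" "j \<in> nbi i"
  shows "dr j i = (dr i j + 2) mod 4"
proof (rule dr_unique(2))
  show "shift (xs ! j) ((dr i j + 2) mod 4) = xs ! i"
    using dr[OF assms] shift_opposite[of "dr i j" "xs ! i"] by simp
qed (use assms nbi_less in auto)

lemma dr_inj: "i < n \<Longrightarrow> inj_on (dr i) (nbi i)"
  by (intro inj_onI) (metis dr(2) nbi_less nth_eq)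

lemma dirs_nth: "i < n \<Longrightarrow> dirs N (xs ! i) = dr i ` nbi i"
proof (intro set_eqI iffI)
  fix d assume i: "i < n" and "d \<in> dirs N (xs ! i)"
  then obtain j where "j < n" "d < 4" "shift (xs ! i) d = xs ! j"
    by (auto simp: dirs_def in_set_conv_nth)
  with i dr_unique[of i j d] show "d \<in> dr i ` nbi i" by blast
next
  fix d assume i: "i < n" and "d \<in> dr i ` nbi i"
  with dr nbi_less show "d \<in> dirs N (xs ! i)" by (auto simp: dirs_def)
qed

lemma view_nth:
  assumes "i < n"
  shows "(\<lambda>d. (d, f (shift (xs ! i) d))) ` dirs N (xs ! i) = (\<lambda>j. (dr i j, f (xs ! j))) ` nbi i"
  unfolding dirs_nth[OF assms] image_image using dr(2)[OF assms] by simp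

lemma shift_dirs_nth:
  assumes "i < n"
  shows "(\<lambda>d. f (shift (xs ! i) d)) ` dirs N (xs ! i) = (\<lambda>j. f (xs ! j)) ` nbi i"
  unfolding dirs_nth[OF assms] image_image using dr(2)[OF assms] by simp

lemma srun_Suc:
  assumes "i < n" "\<And>j. j < n \<Longrightarrow> srun T N t (xs ! j) = \<phi> j"
  shows "srun T N (Suc t) (xs ! i) = step T (\<phi> i) ((\<lambda>j. (dr i j, \<phi> j)) ` nbi i)"
proof -
  have "(\<lambda>j. (dr i j, srun T N t (xs ! j))) ` nbi i = (\<lambda>j. (dr i j, \<phi> j)) ` nbi i"
    using assms(2) nbi_less by (intro image_cong) auto
  then show ?thesis
    using assms by (simp add: view_nth)
qed

definition idx :: "pos \<Rightarrow> nat" where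
  "idx v = (THE i. i < n \<and> xs ! i = v)"

lemma idx: "i < n \<Longrightarrow> idx (xs ! i) = i"
  unfolding idx_def using nth_eq by (intro the_equality) auto

lemma nbi_simps:
  "1 < n \<Longrightarrow> nbi 0 = {1}"
  "0 < i \<Longrightarrow> i < n - 1 \<Longrightarrow> nbi i = {i - 1, i + 1}"
  "1 < n \<Longrightarrow> nbi (n - 1) = {n - 1 - 1}"
  by (auto simp: nbi_def)

text \<open>With the only general at an end, the index itself is the distance, and the path is
  layered with \<open>m = n - 1\<close>.\<close>

lemma fires_from_end:
  assumes "\<And>i. i < n \<Longrightarrow> srun T N t0 (xs ! i) = (if i = 0 then G0 else Quiet)"
  shows "fires_from T N t0"
proof (rule layered_fires)
  show "layered N idx (n - 1)"
    unfolding layered_def all_set_conv_all_nth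
  proof (intro allI impI conjI)
    fix i assume i: "i < n"
    then show "idx (xs ! i) \<le> n - 1" by (simp add: idx)
    assume n: "0 < n - 1"
    have "(\<lambda>d. idx (shift (xs ! i) d)) ` dirs N (xs ! i) = (\<lambda>j. j) ` nbi i"
      unfolding shift_dirs_nth[OF i, of idx] using idx nbi_less by (intro image_cong) auto
    then have Z: "(\<lambda>d. idx (shift (xs ! i) d)) ` dirs N (xs ! i) = nbi i" by simp
    have "i = 0 \<and> nbi i = {1} \<or> 0 < i \<and> i < n - 1 \<and> nbi i = {i - 1, i + 1}
        \<or> i = n - 1 \<and> nbi i = {n - 1 - 1}"
      using i n nbi_simps by (cases "i = 0"; cases "i = n - 1") auto
    then show "let Z = (\<lambda>d. idx (shift (xs ! i) d)) ` dirs N (xs ! i) in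
       (idx (xs ! i) = 0 \<longrightarrow> 1 \<in> Z \<and> Z \<subseteq> {0, 1}) \<and>
       (0 < idx (xs ! i) \<and> idx (xs ! i) < n - 1 \<longrightarrow> Z = {idx (xs ! i) - 1, idx (xs ! i) + 1}) \<and>
       (idx (xs ! i) = n - 1 \<longrightarrow> n - 1 - 1 \<in> Z \<and> Z \<subseteq> {n - 1 - 1, n - 1})"
      unfolding Z idx[OF i] Let_def using n by (elim disjE conjE) auto
  qed
  show "srun T N t0 v = stage (n - 1) 0 (idx v)" if "v \<in> N" for v
    using that assms by (auto simp: in_set_conv_nth idx stage_def)
qed

text \<open>The signal is at index \<open>k - u\<close> with one \<open>Blk\<close> behind it; the
  sums avoid truncated subtraction.\<close>

definition travel :: "nat \<Rightarrow> nat \<Rightarrow> nat \<Rightarrow> st" where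
  "travel d u i = (if i + u = k then (if u = 0 then Src d else Trav)
     else if i + u = Suc k \<and> 0 < u then Blk else Quiet)"

lemma travel_not_Fired: "travel d u i \<noteq> Fired"
  by (simp add: travel_def)

lemma travel_run:
  assumes "0 < k" and d: "d = dr k (k - 1)"
    and init: "\<And>i. i < n \<Longrightarrow> srun T N t0 (xs ! i) = (if i = k then Src d else Quiet)"
    and "u \<le> k" "i < n"
  shows "srun T N (t0 + u) (xs ! i) = travel d u i"
  using assms(4,5)
proof (induction u arbitrary: i)
  case 0
  then show ?case using init by (simp add: travel_def)
next
  case (Suc u)
  define Y where "Y = (\<lambda>j. (dr i j, travel d u j)) ` nbi i"
  have run: "srun T N (t0 + Suc u) (xs ! i) = step T (travel d u i) Y"
    using srun_Suc[OF \<open>i < n\<close>, of T "t0 + u" "travel d u"] Suc by (simp add: Y_def)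
  consider "i + u = k" | "i + u = Suc k" "0 < u" | "i + u \<noteq> k" "\<not> (i + u = Suc k \<and> 0 < u)"
    by blast
  then show ?case
  proof cases
    case 1
    have "i - 1 \<in> nbi i" using 1 Suc.prems by (auto simp: nbi_def)
    moreover have "travel d u (i - 1) = Quiet" using 1 Suc.prems by (auto simp: travel_def)
    ultimately have "Quiet \<in> snd ` Y" unfolding Y_def by force
    moreover have "travel d u i = (if u = 0 then Src d else Trav)" "travel d (Suc u) i = Blk"
      using 1 by (simp_all add: travel_def)
    ultimately show ?thesis unfolding run by (simp add: step_simps)
  next
    case 2
    then show ?thesis unfolding run by (simp add: travel_def step_simps)
  next
    case 3
    then have Q: "travel d u i = Quiet" by (auto simp: travel_def)
    have na: "\<not> (\<exists>y\<in>snd ` Y. active y)" "\<not> (\<exists>y\<in>snd ` Y. front y)"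
      by (auto simp: travel_def Y_def)
    have "Trav \<in> snd ` Y \<or> (\<exists>e. (e, Src ((e + 2) mod 4)) \<in> Y) \<longleftrightarrow> i + Suc u = k"
    proof
      assume L: "i + Suc u = k"
      then have i: "Suc i \<in> nbi i" using k(1) by (auto simp: nbi_def)
      show "Trav \<in> snd ` Y \<or> (\<exists>e. (e, Src ((e + 2) mod 4)) \<in> Y)"
      proof (cases "u = 0")
        case True
        have "dr k i = (dr i (Suc i) + 2) mod 4"
          using dr_opposite[OF \<open>i < n\<close> i] L True by simp
        moreover have "d = dr k i" using d L True by auto
        ultimately have "(dr i (Suc i), Src ((dr i (Suc i) + 2) mod 4)) = (dr i (Suc i), travel d u (Suc i))"
          using L True by (simp add: travel_def)
        then have "(dr i (Suc i), Src ((dr i (Suc i) + 2) mod 4)) \<in> Y"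
          unfolding Y_def using i by (rule image_eqI)
        then show ?thesis by blast
      next
        case False
        then have "travel d u (Suc i) = Trav" using L by (simp add: travel_def)
        then show ?thesis using i unfolding Y_def by force
      qed
    next
      assume "Trav \<in> snd ` Y \<or> (\<exists>e. (e, Src ((e + 2) mod 4)) \<in> Y)"
      then obtain j where j: "j \<in> nbi i"
        and tj: "travel d u j = Trav \<or> travel d u j = Src ((dr i j + 2) mod 4)"
        unfolding Y_def by auto
      then have jk: "j + u = k" by (auto simp: travel_def split: if_splits)
      \<comment> \<open>The signal cannot turn back: for \<open>0 < u\<close> the node behind it is
        \<open>Blk\<close> and not asleep, and for \<open>u = 0\<close> the direction
        \<open>d\<close> leads to \<open>k - 1\<close>, not to \<open>k + 1\<close>.\<close>
      have "i \<noteq> Suc j"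
      proof
        assume i: "i = Suc j"
        with 3 jk have u: "u = 0" by auto
        then have "d = dr j i" using tj jk dr_opposite[OF \<open>i < n\<close> j] by (auto simp: travel_def)
        then have "dr k (Suc k) = dr k (k - 1)" using d i u jk by simp
        moreover have "Suc k \<in> nbi k" "k - 1 \<in> nbi k"
          using i jk u Suc.prems \<open>0 < k\<close> by (auto simp: nbi_def)
        ultimately show False using dr_inj[OF k(1)] by (auto dest: inj_onD)
      qed
      then show "i + Suc u = k" using j jk by (auto simp: nbi_def)
    qed
    then have "step T Quiet Y = (if i + Suc u = k then Trav else Quiet)"
      using na by (simp add: step_simps)
    then show ?thesis unfolding run Q using 3 by (auto simp: travel_def)
  qed
qed

text \<open>The signal needs \<open>k\<close> steps to index 0 and one more to turn into
  \<open>G0\<close>; in that step the \<open>Blk\<close> behind it falls asleep.\<close>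

lemma fires_from_Src:
  assumes "0 < k" and d: "d = dr k (k - 1)"
    and init: "\<And>i. i < n \<Longrightarrow> srun T N t0 (xs ! i) = (if i = k then Src d else Quiet)"
  shows "fires_from T N t0"
proof (rule fires_from_later[where u = "Suc k"])
  note run = travel_run[OF assms]
  show "srun T N (t0 + t) v \<noteq> Fired" if "t < Suc k" "v \<in> N" for t v
    using that run[of t] travel_not_Fired by (auto simp: in_set_conv_nth)
  show "fires_from T N (t0 + Suc k)"
  proof (rule fires_from_end)
    fix i assume i: "i < n"
    let ?Y = "(\<lambda>j. (dr i j, travel d k j)) ` nbi i"
    have "srun T N (t0 + Suc k) (xs ! i) = step T (travel d k i) ?Y"
      using srun_Suc[OF i, of T "t0 + k" "travel d k"] run by simp
    also have "\<dots> = (if i = 0 then G0 else Quiet)"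
    proof -
      have X: "snd ` ?Y = travel d k ` nbi i" by (simp add: image_image)
      consider "i = 0" | "i = 1" | "i \<ge> 2" by linarith
      then show ?thesis
      proof cases
        case 1
        \<comment> \<open>The end recognises itself by seeing only the \<open>Blk\<close>; inside
          the path the node ahead would be asleep.\<close>
        then have "Quiet \<notin> snd ` ?Y" unfolding X using \<open>0 < k\<close> by (auto simp: travel_def nbi_def)
        then show ?thesis using 1 \<open>0 < k\<close> by (simp add: travel_def step_simps)
      next
        case 2
        then show ?thesis using \<open>0 < k\<close> by (simp add: travel_def step_simps)
      next
        case 3
        then have "snd ` ?Y \<subseteq> {Blk, Quiet}" unfolding X by (auto simp: travel_def nbi_def)
        then have "step T Quiet ?Y = Quiet" by (rule step_inert)
        then show ?thesis using 3 by (simp add: travel_def)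
      qed
    qed
    finally show "srun T N (t0 + Suc k) (xs ! i) = (if i = 0 then G0 else Quiet)" .
  qed
qed

end

subsection \<open>Spreading the arm lengths\<close>

lemma finish_dirs: "s \<noteq> 4 \<Longrightarrow> finish T s t K D = finish T s t K D'"
  by (simp add: finish_def)

text \<open>This is \<open>|i - j|\<close>, since one of the two truncated differences is 0.\<close>

definition gap :: "nat \<Rightarrow> nat \<Rightarrow> nat" where
  "gap i j = (i - j) + (j - i)"

context path
begin

text \<open>The direction chosen by \<open>SOME\<close> is unknown, so the list is reversed if the
  signal runs towards higher indices, and also if the general is at the last index.\<close>

lemma fires_from_start:
  assumes init: "\<And>i. i < n \<Longrightarrow> srun T N t0 (xs ! i) = (if i = k then start (dirs N (xs ! k)) else Quiet)"
  shows "fires_from T N t0"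
proof -
  interpret rev: path "rev xs" "n - 1 - k"
    using cfg_list_rev[OF cfg] by unfold_locales
  have rinit: "srun T N t0 (rev xs ! i) = (if i = n - 1 - k then start (dirs N (xs ! k)) else Quiet)"
    if "i < n" for i
  proof -
    have "n - Suc i = k \<longleftrightarrow> i = n - 1 - k" using that k(1) by linarith
    then show ?thesis using that init[of "n - Suc i"] by (simp add: rev_nth)
  qed
  have card: "card (dirs N (xs ! k)) = card (nbi k)"
    by (simp add: dirs_nth[OF k(1)] card_image dr_inj[OF k(1)])
  consider "k = 0" | "k = n - 1" | "0 < k" "k < n - 1"
    using k(1) by linarith
  then show ?thesis
  proof cases
    case 1
    then have "nbi k \<subseteq> {1}" by (auto simp: nbi_def)
    then have "card (nbi k) \<le> 1" using card_mono[of "{1}" "nbi k"] by simp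
    then show ?thesis using 1 init card by (intro fires_from_end) (simp add: start_def)
  next
    case 2
    then have "nbi k \<subseteq> {k - 1}" by (auto simp: nbi_def)
    then have "card (nbi k) \<le> 1" using card_mono[of "{k - 1}" "nbi k"] by simp
    then have "fires_from T (set (rev xs)) t0"
      using 2 rinit card by (intro rev.fires_from_end) (simp add: start_def)
    then show ?thesis by simp
  next
    case 3
    define d where "d = (SOME d. d \<in> dirs N (xs ! k))"
    have nbi: "nbi k = {k - 1, k + 1}" using 3 by (rule nbi_simps)
    then have "start (dirs N (xs ! k)) = Src d"
      using card 3 by (simp add: start_def d_def)
    moreover have "dirs N (xs ! k) \<noteq> {}" using nbi by (simp add: dirs_nth[OF k(1)])
    then have "d \<in> dirs N (xs ! k)" unfolding d_def by (rule some_in_eq[THEN iffD2])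
    then consider "d = dr k (k - 1)" | "d = dr k (Suc k)"
      using nbi by (auto simp: dirs_nth[OF k(1)])
    then show ?thesis
    proof cases
      case 1
      then show ?thesis using 3 init \<open>start _ = _\<close> by (intro fires_from_Src) auto
    next
      case 2
      have "Suc k \<in> nbi k" using nbi by simp
      then have "d < 4" "shift (xs ! k) d = xs ! Suc k" using dr[OF k(1)] 2 by auto
      moreover have "rev xs ! (n - 1 - k) = xs ! k" "rev xs ! (n - 1 - k - 1) = xs ! Suc k"
        using 3 by (simp_all add: rev_nth Suc_diff_Suc)
      ultimately have "d = rev.dr (n - 1 - k) (n - 1 - k - 1)"
        using 3 by (intro rev.dr_unique(2)[symmetric]) auto
      then have "fires_from T (set (rev xs)) t0"
        using 3 rinit \<open>start _ = _\<close> by (intro rev.fires_from_Src) auto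
      then show ?thesis by simp
    qed
  qed
qed

section \<open>Closed form of the first \<open>T\<close> steps\<close>

definition org :: "nat \<Rightarrow> nat" where
  "org d = (if 0 < k \<and> d = dr k (k - 1) then 0 else if Suc k < n \<and> d = dr k (Suc k) then n - 1 else k)"

definition arm :: "nat \<Rightarrow> nat" where
  "arm d = gap (org d) k"

definition side :: "nat \<Rightarrow> nat" where
  "side i = (if i < k then dr k (k - 1) else if i = k then 4 else dr k (Suc k))"

text \<open>The length of arm \<open>d\<close> is discovered at \<open>org d\<close>, the end of the
  arm or the general if there is no arm, when the wave from the general arrives at time
  \<open>arm d\<close>. From there it spreads with speed 1.\<close>

definition know :: "nat \<Rightarrow> nat \<Rightarrow> (nat \<times> nat) set" where
  "know t i = (\<lambda>d. (d, arm d)) ` {d. d < 4 \<and> arm d + gap (org d) i \<le> t}"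

definition aware :: "nat \<Rightarrow> nat \<Rightarrow> nat \<Rightarrow> st" where
  "aware T t i = (if t < gap i k then Quiet else finish T (side i) t (know t i) (dirs N (xs ! i)))"

lemma side_k: "side k = 4"
  by (simp add: side_def)

lemma org_less: "org d < n"
  using k(1) by (auto simp: org_def)

lemma dr_less: "j \<in> nbi k \<Longrightarrow> dr k j < 4"
  using dr(1)[OF k(1)] .

lemma dr_neq: "0 < k \<Longrightarrow> Suc k < n \<Longrightarrow> dr k (k - 1) \<noteq> dr k (Suc k)"
  using dr_inj[OF k(1)] by (auto simp: nbi_def dest: inj_onD)

text \<open>A signal starts at index \<open>b\<close> at time \<open>e\<close> with speed 1; if
  \<open>i\<close> is not \<open>b\<close>, the neighbour closer to \<open>b\<close> has it one step
  earlier.\<close>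

lemma gap_step:
  assumes "b < n" "i < n"
  shows "e + gap b i \<le> Suc t \<longleftrightarrow>
    e + gap b i \<le> t \<or> (\<exists>j\<in>nbi i. e + gap b j \<le> t) \<or> b = i \<and> e = Suc t" (is "?L \<longleftrightarrow> ?R")
proof
  assume L: ?L
  consider "b = i" | "b < i" | "i < b" by linarith
  then show ?R
  proof cases
    case 1
    then show ?thesis using L by (auto simp: gap_def)
  next
    case 2
    then have "i - 1 \<in> nbi i" "e + gap b (i - 1) \<le> t" using L assms by (auto simp: nbi_def gap_def)
    then show ?thesis by blast
  next
    case 3
    then have "Suc i \<in> nbi i" "e + gap b (Suc i) \<le> t" using L assms by (auto simp: nbi_def gap_def)
    then show ?thesis by blast
  qed
next
  assume ?R
  then show ?L by (auto simp: nbi_def gap_def)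
qed

lemma know_Suc:
  assumes "i < n"
  shows "know (Suc t) i = know t i \<union> \<Union> (know t ` nbi i)
    \<union> (\<lambda>d. (d, arm d)) ` {d. d < 4 \<and> org d = i \<and> arm d = Suc t}"
  unfolding know_def using gap_step[OF org_less assms] by auto

text \<open>By the triangle inequality no fact overtakes the wave from the general: the way to
  \<open>i\<close> through \<open>org d\<close> is no shorter than the direct one.\<close>

lemma know_empty: "t < gap i k \<Longrightarrow> know t i = {}"
  by (auto simp: know_def arm_def gap_def)

lemma org_eq:
  assumes "i < n" "i \<noteq> k" "d < 4"
  shows "org d = i \<longleftrightarrow> (i = 0 \<or> i = n - 1) \<and> d = side i"
  using assms k(1) dr_neq by (auto simp: org_def side_def)

text \<open>\<open>j\<close> is the neighbour that wakes \<open>i\<close>; this matches the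
  computation of \<open>s'\<close> in \<open>wake\<close>.\<close>

lemma side_toward:
  assumes "i < n" "j \<in> nbi i" "gap j k < gap i k"
  shows "side i = (if side j = 4 then (dr i j + 2) mod 4 else side j)" "side i < 4"
proof -
  have "k - 1 \<in> nbi k" if "0 < k" using that k(1) by (auto simp: nbi_def)
  moreover have "Suc k \<in> nbi k" if "Suc k < n" using that by (auto simp: nbi_def)
  ultimately have lt: "0 < k \<Longrightarrow> dr k (k - 1) < 4" "Suc k < n \<Longrightarrow> dr k (Suc k) < 4"
    using dr_less by auto
  consider "i < k" "j = Suc i" | "k < i" "i = Suc j"
    using assms by (auto simp: nbi_def gap_def)
  then have "side i < 4 \<and> side i = (if side j = 4 then (dr i j + 2) mod 4 else side j)"
  proof cases
    case 1
    then have si: "side i = dr k (k - 1)" "side i < 4" using lt(1) by (auto simp: side_def)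
    moreover have "side j = side i" if "j \<noteq> k" using 1 that by (simp add: side_def)
    moreover have "side i = (dr i j + 2) mod 4" if "j = k"
    proof -
      have "k - 1 = i" using 1 that by simp
      then show ?thesis using si(1) dr_opposite[OF assms(1,2)] that by simp
    qed
    ultimately show ?thesis using side_k by (cases "j = k") auto
  next
    case 2
    then have si: "side i = dr k (Suc k)" "side i < 4" using lt(2) assms(1) by (auto simp: side_def)
    moreover have "side j = side i" if "j \<noteq> k" using 2 that by (simp add: side_def)
    moreover have "side i = (dr i j + 2) mod 4" if "j = k"
    proof -
      have "Suc k = i" using 2 that by simp
      then show ?thesis using si(1) dr_opposite[OF assms(1,2)] that by simp
    qed
    ultimately show ?thesis using side_k by (cases "j = k") auto
  qed
  then show "side i = (if side j = 4 then (dr i j + 2) mod 4 else side j)" "side i < 4"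
    by auto
qed

lemma aware_run:
  assumes "t \<le> T" "i < n"
  shows "srun T N t (xs ! i) = aware T t i"
  using assms
proof (induction t arbitrary: i)
  case 0
  have i: "xs ! i = (0, 0) \<longleftrightarrow> i = k" using nth_eq[OF 0(2) k(1)] k(2) by simp
  have dirs: "dirs N (xs ! k) = {d. 0 < k \<and> d = dr k (k - 1) \<or> Suc k < n \<and> d = dr k (Suc k)}"
    using k(1) unfolding dirs_nth[OF k(1)] nbi_def by (auto simp: image_iff)
  have org: "org d = k \<longleftrightarrow> d \<notin> dirs N (xs ! k)" for d
  proof -
    let ?L = "0 < k \<and> d = dr k (k - 1)" and ?R = "Suc k < n \<and> d = dr k (Suc k)"
    have "0 \<noteq> k" if ?L using that by simp
    moreover have "n - 1 \<noteq> k" if ?R using that by linarith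
    ultimately show ?thesis unfolding dirs org_def mem_Collect_eq by presburger
  qed
  have "arm d + gap (org d) k \<le> 0 \<longleftrightarrow> org d = k" for d
    by (auto simp: arm_def gap_def)
  then have "know 0 k = (\<lambda>d. (d, arm d)) ` {d. d < 4 \<and> org d = k}"
    by (simp add: know_def)
  also have "\<dots> = (\<lambda>d. (d, 0)) ` {d. d < 4 \<and> org d = k}"
    by (rule image_cong) (auto simp: arm_def gap_def)
  also have "\<dots> = ({..<4} - dirs N (xs ! k)) \<times> {0}"
    unfolding org by auto
  finally have know: "know 0 k = ({..<4} - dirs N (xs ! k)) \<times> {0}" .
  show ?case
  proof (cases "i = k")
    case True
    then show ?thesis using k(2) by (simp add: aware_def gen_def side_k gap_def know)
  next
    case False
    then have "0 < gap i k" by (auto simp: gap_def)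
    then show ?thesis using i False by (simp add: aware_def)
  qed
next
  case (Suc t)
  define Y where "Y = (\<lambda>j. (dr i j, aware T t j)) ` nbi i"
  have run: "srun T N (Suc t) (xs ! i) = step T (aware T t i) Y"
    using srun_Suc[OF \<open>i < n\<close>, of T t "aware T t"] Suc by (simp add: Y_def)
  have aware: "aware T t j = (if t < gap j k then Quiet else Act (side j) t (know t j))" for j
    using Suc.prems by (simp add: aware_def finish_def)
  have Y: "snd ` Y = aware T t ` nbi i" by (simp add: Y_def image_image)
  have facts: "facts (aware T t j) = know t j" for j
    using know_empty[of t j] by (simp add: aware)
  consider "gap i k \<le> t" | "gap i k = Suc t" | "Suc t < gap i k" by linarith
  then show ?case
  proof cases
    case 1
    \<comment> \<open>A fact is created when its origin wakes up, which is past for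
      \<open>i\<close>.\<close>
    have "{d. d < 4 \<and> org d = i \<and> arm d = Suc t} = {}" using 1 by (auto simp: arm_def)
    then have "know (Suc t) i = know t i \<union> \<Union> (facts ` snd ` Y)"
      unfolding know_Suc[OF \<open>i < n\<close>, of t] \<open>_ = {}\<close> Y by (simp add: facts)
    moreover have "fst ` Y = dirs N (xs ! i)"
      by (simp add: Y_def image_image dirs_nth[OF \<open>i < n\<close>])
    ultimately show ?thesis
      unfolding run using 1 by (simp add: aware step_simps) (simp add: aware_def)
  next
    case 2
    then have "i \<noteq> k" by (auto simp: gap_def)
    define j where "j = (if i < k then Suc i else i - 1)"
    have j: "j \<in> nbi i" "gap j k = t"
      using 2 Suc.prems k(1) by (auto simp: j_def nbi_def gap_def)
    have far: "t < gap l k" if "l \<in> nbi i" "l \<noteq> j" for l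
      using that 2 by (auto simp: j_def nbi_def gap_def split: if_splits)
    have aj: "aware T t j = Act (side j) t (know t j)" using j by (simp add: aware)
    have al: "aware T t l = Quiet" if "l \<in> nbi i" "l \<noteq> j" for l
      using far[OF that] by (simp add: aware)
    have act: "\<exists>y\<in>snd ` Y. active y" unfolding Y using j aj by force
    \<comment> \<open>\<open>j\<close> is the only active neighbour, so the choice in
      \<open>step\<close> is determined.\<close>
    have "y = (dr i j, Act (side j) t (know t j))" if "y \<in> Y" "active (snd y)" for y
      using that al aj unfolding Y_def by force
    with some_active[OF act]
    have some: "(SOME y. y \<in> Y \<and> active (snd y)) = (dr i j, Act (side j) t (know t j))"
      by auto
    \<comment> \<open>A neighbour on the far side is still asleep, so \<open>i\<close> sees
      \<open>Quiet\<close> exactly if it is not an end.\<close>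
    have quiet: "Quiet \<in> snd ` Y \<longleftrightarrow> i \<noteq> 0 \<and> i \<noteq> n - 1"
    proof
      assume "Quiet \<in> snd ` Y"
      then obtain l where "l \<in> nbi i" "aware T t l = Quiet" unfolding Y by (metis imageE)
      moreover from this have "l \<noteq> j" using aj by auto
      ultimately show "i \<noteq> 0 \<and> i \<noteq> n - 1" using j by (auto simp: nbi_def)
    next
      assume i: "i \<noteq> 0 \<and> i \<noteq> n - 1"
      define l where "l = (if i < k then i - 1 else Suc i)"
      have "l \<in> nbi i" "l \<noteq> j" using i Suc.prems by (auto simp: l_def j_def nbi_def)
      then show "Quiet \<in> snd ` Y" unfolding Y using al by force
    qed
    have si: "(if side j = 4 then (dr i j + 2) mod 4 else side j) = side i" "side i < 4"
      using side_toward[OF \<open>i < n\<close> j(1)] j(2) 2 by auto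
    have "wake T (dr i j, Act (side j) t (know t j)) (snd ` Y) = finish T (side i) (Suc t)
       (if Quiet \<in> snd ` Y then know t j else insert (side i, Suc t) (know t j)) {}"
      unfolding wake.simps Let_def si ..
    also have "\<dots> = finish T (side i) (Suc t)
       (if Quiet \<in> snd ` Y then know t j else insert (side i, Suc t) (know t j)) (dirs N (xs ! i))"
      using si(2) by (intro finish_dirs) simp
    also have "(if Quiet \<in> snd ` Y then know t j else insert (side i, Suc t) (know t j)) = know (Suc t) i"
    proof -
      have "{d. d < 4 \<and> org d = i \<and> arm d = Suc t} = (if i = 0 \<or> i = n - 1 then {side i} else {})"
      proof -
        have "arm d = Suc t" if "org d = i" for d using 2 that by (simp add: arm_def)
        then have "d < 4 \<and> org d = i \<and> arm d = Suc t \<longleftrightarrow> d < 4 \<and> org d = i" for d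
          by blast
        also have "d < 4 \<and> org d = i \<longleftrightarrow> (i = 0 \<or> i = n - 1) \<and> d = side i" for d
          using org_eq[OF \<open>i < n\<close> \<open>i \<noteq> k\<close>, of d] si(2) by metis
        finally have "{d. d < 4 \<and> org d = i \<and> arm d = Suc t} = {d. (i = 0 \<or> i = n - 1) \<and> d = side i}"
          by presburger
        also have "\<dots> = (if i = 0 \<or> i = n - 1 then {side i} else {})" by simp
        finally show ?thesis .
      qed
      moreover have "arm (side i) = Suc t" if "i = 0 \<or> i = n - 1"
      proof -
        have "org (side i) = i"
          using org_eq[OF \<open>i < n\<close> \<open>i \<noteq> k\<close> \<open>side i < 4\<close>] that by blast
        then show ?thesis using 2 by (simp add: arm_def)
      qed
      moreover have "\<Union> (know t ` nbi i) = know t j"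
        using j(1) far know_empty by fastforce
      moreover have "know t i = {}" using know_empty 2 by simp
      ultimately show ?thesis
        unfolding know_Suc[OF \<open>i < n\<close>] quiet by auto
    qed
    finally have "step T Quiet Y = finish T (side i) (Suc t) (know (Suc t) i) (dirs N (xs ! i))"
      using act some by (simp add: step_simps)
    then show ?thesis
      unfolding run using 2 by (simp add: aware) (simp add: aware_def)
  next
    case 3
    have "aware T t l = Quiet" if "l \<in> nbi i" for l
      using that 3 by (auto simp: aware nbi_def gap_def)
    then have "snd ` Y \<subseteq> {Quiet}" unfolding Y by auto
    then show ?thesis
      unfolding run using 3 by (simp add: aware step_quiet) (simp add: aware_def)
  qed
qed

section \<open>Arm lengths and the critical time\<close>

lemma arm_eq: "arm d = (if 0 < k \<and> d = dr k (k - 1) then k else 0)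
    + (if Suc k < n \<and> d = dr k (Suc k) then n - 1 - k else 0)"
  using k(1) dr_neq by (auto simp: arm_def org_def gap_def)

lemma nbi_k: "0 < k \<Longrightarrow> k - 1 \<in> nbi k" "Suc k < n \<Longrightarrow> Suc k \<in> nbi k"
  using k(1) by (auto simp: nbi_def)

lemma sum_arm: "(\<Sum>d<4. arm d) = n - 1"
proof -
  have "(\<Sum>d<4. if 0 < k \<and> d = dr k (k - 1) then k else 0) = k"
    using dr_less[OF nbi_k(1)] by (cases "k = 0") auto
  moreover have "(\<Sum>d<4. if Suc k < n \<and> d = dr k (Suc k) then n - 1 - k else 0) = n - 1 - k"
    using dr_less[OF nbi_k(2)] k(1) by (cases "Suc k < n") auto
  ultimately show ?thesis
    using k(1) by (simp add: arm_eq sum.distrib)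
qed

lemma Max_arm: "Max (arm ` {..<4}) = max k (n - 1 - k)"
proof (rule Max_eqI)
  show "y \<le> max k (n - 1 - k)" if "y \<in> arm ` {..<4}" for y
    using that dr_neq by (auto simp: arm_eq)
  have "k \<in> arm ` {..<4}" if "0 < k"
    using that dr_less[OF nbi_k(1)] dr_neq by (intro image_eqI[of _ _ "dr k (k - 1)"]) (auto simp: arm_eq)
  moreover have "n - 1 - k \<in> arm ` {..<4}" if "Suc k < n"
    using that dr_less[OF nbi_k(2)] dr_neq by (intro image_eqI[of _ _ "dr k (Suc k)"]) (auto simp: arm_eq)
  moreover have "0 \<in> arm ` {..<4}" if "k = 0" "n = 1"
  proof (rule image_eqI)
    show "0 = arm 0" unfolding arm_eq using that by simp
  qed simp
  ultimately show "max k (n - 1 - k) \<in> arm ` {..<4}"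
    using k(1) by (cases "k = 0"; cases "Suc k < n") (auto simp: max_def)
qed simp

text \<open>All nodes decide alike. At the critical time every fact is known everywhere, being
  created by time \<open>max k (n - 1 - k)\<close> and crossing at most \<open>n - 1\<close> edges.
  At any other \<open>T\<close> a node either misses a fact or computes a value different from
  \<open>T\<close>.\<close>

lemma crit_know:
  assumes "i < n"
  shows "crit T (know T i) \<longleftrightarrow> T = n - 1 + max k (n - 1 - k)"
proof -
  let ?A = "{d. d < 4 \<and> arm d + gap (org d) i \<le> T}"
  have inj: "inj_on (\<lambda>d. (d, arm d)) D" for D by (rule inj_onI) simp
  have fst: "fst ` know T i = ?A" by (simp add: know_def image_image)
  have full: "crit T (know T i) \<longleftrightarrow> T = n - 1 + max k (n - 1 - k)" if "?A = {..<4}"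
  proof -
    have "know T i = (\<lambda>d. (d, arm d)) ` {..<4}" using that by (simp add: know_def)
    then have "sum snd (know T i) = n - 1" "Max (snd ` know T i) = max k (n - 1 - k)"
      using sum_arm Max_arm by (simp_all add: sum.reindex[OF inj] image_image)
    then show ?thesis using that fst by (auto simp: crit_def)
  qed
  have "?A = {..<4}" if "T = n - 1 + max k (n - 1 - k)"
  proof -
    have "arm d + gap (org d) i \<le> T" for d
      using that assms k(1) by (auto simp: arm_def org_def gap_def max_def)
    then show ?thesis by auto
  qed
  with full fst show ?thesis by (auto simp: crit_def)
qed

lemma srun_fires:
  obtains t where "\<And>t' v. t' < t \<Longrightarrow> v \<in> N \<Longrightarrow> srun T N t' v \<noteq> Fired"
    "\<And>v. v \<in> N \<Longrightarrow> srun T N t v = Fired"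
    "T = n - 1 + max k (n - 1 - k) \<Longrightarrow> t = T"
proof -
  have before: "srun T N t v \<noteq> Fired" if "t < T" "v \<in> N" for t v
    using that by (auto simp: in_set_conv_nth aware_run aware_def finish_def split: if_splits)
  show thesis
  proof (cases "T = n - 1 + max k (n - 1 - k)")
    case True
    have "gap i k \<le> T" if "i < n" for i
      using that k(1) True by (auto simp: gap_def max_def)
    then have "srun T N T v = Fired" if "v \<in> N" for v
      using that crit_know[of _ T] True
      by (auto simp: in_set_conv_nth aware_run aware_def finish_def not_less[symmetric])
    with before show thesis by (intro that[of T]) auto
  next
    case False
    have "srun T N T (xs ! i) = (if i = k then start (dirs N (xs ! k)) else Quiet)" if "i < n" for i
    proof -
      have "side i = 4 \<longleftrightarrow> i = k"
        using that k(1) dr_less[OF nbi_k(1)] dr_less[OF nbi_k(2)] by (auto simp: side_def)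
      then show ?thesis
        using that crit_know[OF that, of T] False
        by (auto simp: aware_run aware_def finish_def gap_def)
    qed
    then have "fires_from T N T" by (rule fires_from_start)
    then obtain t1 where "T \<le> t1" "\<forall>v\<in>N. srun T N t1 v = Fired"
      "\<And>t v. T \<le> t \<Longrightarrow> t < t1 \<Longrightarrow> v \<in> N \<Longrightarrow> srun T N t v \<noteq> Fired"
      unfolding fires_from_def by blast
    with before False show thesis by (intro that[of t1]) (metis not_le)+
  qed
qed

end

subsection \<open>The lower bound\<close>

lemma cfg_of_config:
  assumes "is_config r s p"
  shows "cfg_list (map p [r..s]) (nat (- r))" "set (map p [r..s]) = cpos r s p"
    "length (map p [r..s]) = nat (- r) + nat s + 1"
  using assms by (auto simp: is_config_def cpos_def)

lemma config_of_cfg: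
  assumes "cfg_list ys k"
  obtains r s p where "is_config r s p" "cpos r s p = set ys"
proof -
  define r s p where "r = - int k" and "s = int (length ys) - 1 - int k" and "p z = ys ! nat (z + int k)" for z
  have k: "k < length ys" using assms by (simp add: cfg_list_def)
  have "map p [r..s] = ys"
    by (rule nth_equalityI) (use k in \<open>auto simp: r_def s_def p_def\<close>)
  then have "is_config r s p"
    using assms k by (simp add: is_config_def r_def s_def)
  moreover have "cpos r s p = set ys"
    using cfg_of_config(2)[OF calculation] \<open>map p [r..s] = ys\<close> by simp
  ultimately show thesis by (rule that)
qed

lemma solution_fires:
  assumes "solution A" "cfg_list ys k"
  obtains t where "fires_at A (set ys) t"
  using assms config_of_cfg[OF assms(2)] unfolding solution_def by metis

lemma dirs_mem:
  assumes "dirs N v = dirs N' v" "d < 4"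
  shows "shift v d \<in> N \<longleftrightarrow> shift v d \<in> N'"
  using assms unfolding dirs_def by blast

lemma bc_eqI: "dirs N v = dirs N' v \<Longrightarrow> bc N v = bc N' v"
  using dirs_mem[of N v N'] by (simp add: bc_def)

lemma run_Suc_cong:
  assumes "dirs N v = dirs N' v" "run A N t v = run A N' t v"
    "\<And>d. d \<in> dirs N v \<Longrightarrow> run A N t (shift v d) = run A N' t (shift v d)"
  shows "run A N (Suc t) v = run A N' (Suc t) v"
proof -
  have mem: "shift v d \<in> N \<longleftrightarrow> shift v d \<in> N'" if "d < 4" for d
    using dirs_mem[OF assms(1) that] .
  have eq: "(if shift v d \<in> N then Some (run A N t (shift v d)) else None) =
      (if shift v d \<in> N' then Some (run A N' t (shift v d)) else None)" if "d < 4" for d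
    using assms(3)[of d] mem[OF that] that by (simp add: dirs_def)
  have less: "0 < (4::nat)" "1 < (4::nat)" "2 < (4::nat)" "3 < (4::nat)" by simp_all
  show ?thesis
    unfolding run.simps assms(2) by (simp only: less[THEN eq])
qed

context path
begin

text \<open>A quiescent node stays so until a neighbour has left the quiescent state, so nothing
  spreads faster than one edge per step.\<close>

lemma quiet_before:
  assumes "valid_fsa A" "i < n" "t < gap i k"
  shows "run A N t (xs ! i) = Qs A"
  using assms(2,3)
proof (induction t arbitrary: i)
  case 0
  then have "xs ! i \<noteq> (0, 0)" using nth_eq[OF _ k(1)] k(2) by (auto simp: gap_def)
  then show ?case by simp
next
  case (Suc t)
  have nb: "set_option (if shift (xs ! i) d \<in> N then Some (run A N t (shift (xs ! i) d)) else None)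
      \<subseteq> {Qs A}" if "d < 4" for d
  proof (cases "shift (xs ! i) d \<in> N")
    case True
    then obtain j where j: "j < n" "shift (xs ! i) d = xs ! j" by (metis in_set_conv_nth)
    then have "j \<in> nbi i" using dr_unique(1) Suc.prems that by blast
    then have "t < gap j k" using Suc.prems by (auto simp: nbi_def gap_def)
    then show ?thesis using Suc.IH[OF j(1)] j(2) by simp
  qed simp
  have "run A N t (xs ! i) = Qs A" using Suc by simp
  moreover have "delta A (Qs A) a b c d = Qs A" if "set_option a \<subseteq> {Qs A}" "set_option b \<subseteq> {Qs A}"
    "set_option c \<subseteq> {Qs A}" "set_option d \<subseteq> {Qs A}" for a b c d
    using assms(1) that unfolding valid_fsa_def by blast
  ultimately show ?case
    unfolding run.simps using nb[of 0] nb[of 1] nb[of 2] nb[of 3] by simp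
qed

text \<open>Only the last node of \<open>xs\<close> may have another boundary in \<open>ys\<close>.
  It is quiescent in both runs before time \<open>n - 1 - k\<close>, and a difference then needs
  \<open>n - 1 - i\<close> steps to index \<open>i\<close>. The bound says
  \<open>u < (n - 1 - k) + (n - 1 - i)\<close>.\<close>

lemma run_agree:
  assumes A: "valid_fsa A" and ys: "cfg_list ys k'" and kn: "Suc k < n"
    and bc: "\<And>i. Suc i < n \<Longrightarrow> dirs (set ys) (xs ! i) = dirs N (xs ! i)"
    and last: "k' + (n - 1 - k) < length ys" "ys ! (k' + (n - 1 - k)) = xs ! (n - 1)"
    and "u + i + k + 3 \<le> 2 * n" "i < n"
  shows "run A N u (xs ! i) = run A (set ys) u (xs ! i)"
  using assms(7,8)
proof (induction u arbitrary: i)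
  case 0
  have "dirs (set ys) (0, 0) = dirs N (0, 0)" using bc[OF kn] k(2) by simp
  then have "bc (set ys) (0, 0) = bc N (0, 0)" by (rule bc_eqI)
  then show ?case by simp
next
  case (Suc u)
  show ?case
  proof (cases "i = n - 1")
    case True
    interpret ys: path ys k' using ys by unfold_locales
    have "Suc u < gap i k" using Suc.prems True kn by (simp add: gap_def)
    moreover have "gap (k' + (n - 1 - k)) k' = gap i k" using True kn by (simp add: gap_def)
    ultimately have "run A N (Suc u) (xs ! i) = Qs A"
      "run A (set ys) (Suc u) (ys ! (k' + (n - 1 - k))) = Qs A"
      using quiet_before[OF A Suc.prems(2)] ys.quiet_before[OF A last(1)] by metis+
    then show ?thesis using True last(2) by (simp del: run.simps)
  next
    case False
    then have i: "Suc i < n" using Suc.prems by simp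
    show ?thesis
    proof (rule run_Suc_cong)
      show "dirs N (xs ! i) = dirs (set ys) (xs ! i)" using bc[OF i] by simp
      show "run A N u (xs ! i) = run A (set ys) u (xs ! i)" using Suc by simp
      fix d assume "d \<in> dirs N (xs ! i)"
      then obtain j where j: "j \<in> nbi i" "shift (xs ! i) d = xs ! j"
        using dr(2)[OF Suc.prems(2)] by (auto simp: dirs_nth[OF Suc.prems(2)])
      then have "u + j + k + 3 \<le> 2 * n" "j < n" using Suc.prems by (auto simp: nbi_def)
      then show "run A N u (shift (xs ! i) d) = run A (set ys) u (shift (xs ! i) d)"
        using Suc.IH j(2) by simp
    qed
  qed
qed

text \<open>If the squad fired earlier, the node at index 0 would fire at the same time on
  \<open>ys\<close>, hence all of \<open>ys\<close> would; but the far end of the long tail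
  \<open>x1\<close> is still quiescent then.\<close>

lemma firing_time_ge:
  assumes A: "solution A" and t: "fires_at A N t" and kn: "Suc k < n"
    and ys_def: "ys = x0 @ butlast xs @ x1" and ys: "cfg_list ys (length x0 + k)"
    and bc: "\<And>v. v \<in> set (butlast xs) \<Longrightarrow> bc (set ys) v = bc N v"
    and x1: "t + n < length x1"
  shows "n - 1 + (n - 1 - k) \<le> t"
proof (rule ccontr)
  assume "\<not> ?thesis"
  then have small: "t + k + 3 \<le> 2 * n" using kn by linarith
  have valid: "valid_fsa A" using A by (simp add: solution_def)
  interpret ys: path ys "length x0 + k" using ys by unfold_locales
  have ys_nth: "ys ! (length x0 + i) = xs ! i" if "Suc i < n" for i
    using that less_diff_conv[of i n 1] by (simp add: ys_def nth_append nth_butlast)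
  have D: "dirs (set ys) (xs ! i) = dirs N (xs ! i)" if "Suc i < n" for i
  proof -
    have "xs ! i \<in> set (butlast xs)"
      using that by (metis in_set_conv_nth length_butlast less_diff_conv nth_butlast plus_1_eq_Suc add.commute)
    from bc[OF this] show ?thesis by (metis bits_bc)
  qed
  define l where "l = length x0 + (n - 1)"
  have l: "l < length ys" using x1 by (auto simp: l_def ys_def)
  \<comment> \<open>The tail \<open>x1\<close> begins at the old last position:
    \<open>ys ! l\<close> is adjacent to the node before it, whose boundary is the same in both
    configurations, so it lies on the old path, where the earlier positions are taken.\<close>
  have last: "ys ! l = xs ! (n - 1)"
  proof -
    let ?i = "n - 2"
    have i: "?i < n" "Suc ?i < n" "Suc ?i = n - 1" using kn by auto
    have "adj (ys ! (length x0 + ?i)) (ys ! l)"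
      using l i by (subst ys.adj_iff) (auto simp: ys.nbi_def l_def)
    then have "adj (xs ! ?i) (ys ! l)" using ys_nth[OF i(2)] by simp
    then obtain d where d: "d < 4" "ys ! l = shift (xs ! ?i) d" by (auto simp: adj_def)
    then have "ys ! l \<in> N" using dirs_mem[OF D[OF i(2)] d(1)] l nth_mem[OF l] by simp
    then obtain j where j: "j < n" "ys ! l = xs ! j" by (metis in_set_conv_nth)
    have "\<not> Suc j < n"
    proof
      assume "Suc j < n"
      then have "ys ! (length x0 + j) = ys ! l" using ys_nth j by simp
      then have "length x0 + j = l" using ys.nth_eq[OF _ l, of "length x0 + j"] l \<open>Suc j < n\<close>
        by (simp add: l_def)
      then show False using \<open>Suc j < n\<close> by (simp add: l_def)
    qed
    then have "j = n - 1" using j by linarith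
    then show ?thesis using j by simp
  qed
  have kl: "(length x0 + k) + (n - 1 - k) = l" using kn by (simp add: l_def)
  have agree: "run A N u (xs ! 0) = run A (set ys) u (xs ! 0)" if "u \<le> t" for u
  proof (rule run_agree[OF valid ys kn D])
    show "length x0 + k + (n - 1 - k) < length ys" "ys ! (length x0 + k + (n - 1 - k)) = xs ! (n - 1)"
      unfolding kl using l last by simp_all
    show "u + 0 + k + 3 \<le> 2 * n" using small that by simp
    show "0 < n" using kn by linarith
  qed
  have "0 < n" "length x0 < length ys" using kn x1 by (auto simp: ys_def)
  then have x0: "xs ! 0 \<in> N" "xs ! 0 \<in> set ys"
  proof -
    have "ys ! length x0 = xs ! 0" using ys_nth[of 0] kn by simp
    then show "xs ! 0 \<in> set ys" using \<open>length x0 < length ys\<close> by (metis nth_mem)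
  qed simp
  obtain t' where t': "fires_at A (set ys) t'" using solution_fires[OF A ys] .
  have fire: "run A N t (xs ! 0) \<in> Fire A" "run A (set ys) t' (xs ! 0) \<in> Fire A"
    and idle: "\<And>u. u < t \<Longrightarrow> run A N u (xs ! 0) \<notin> Fire A"
      "\<And>u. u < t' \<Longrightarrow> run A (set ys) u (xs ! 0) \<notin> Fire A"
    using t t' x0 unfolding fires_at_def by blast+
  have "\<not> t < t'" using fire(1) idle(2)[of t] agree[of t] by auto
  moreover have "\<not> t' < t" using fire(2) idle(1)[of t'] agree[of t'] by (metis less_imp_le)
  ultimately have "t' = t" by simp
  define e where "e = length ys - 1"
  have "e < length ys" "t < gap e (length x0 + k)" using x1 kn by (auto simp: e_def gap_def ys_def)
  then have "run A (set ys) t (ys ! e) = Qs A" "ys ! e \<in> set ys"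
    using ys.quiet_before[OF valid] nth_mem by blast+
  moreover have "Qs A \<notin> Fire A" using valid by (simp add: valid_fsa_def)
  ultimately show False using t' \<open>t' = t\<close> unfolding fires_at_def by metis
qed

end

lemma Sup_enat_unbounded:
  assumes "Sup ((\<lambda>x. enat (f x)) ` X) = \<infinity>"
  obtains x where "x \<in> X" "B < f x"
proof -
  have "\<exists>x\<in>X. B < f x"
  proof (rule ccontr)
    assume "\<not> ?thesis"
    then have "Sup ((\<lambda>x. enat (f x)) ` X) \<le> enat B" by (intro Sup_least) (auto simp: not_less)
    then show False using assms by simp
  qed
  then show thesis using that by blast
qed

text \<open>The end of the longer arm is replaced. This arm is non-empty unless the bound is 0, so
  its freedom provides arbitrarily long tails.\<close>

lemma typeI_firing_time_ge:
  assumes c: "is_config r s p" and I: "typeI r s p" and A: "solution A" and t: "fires_at A (cpos r s p) t"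
  shows "nat (- r + s + max (- r) s) \<le> t"
proof -
  let ?xs = "map p [r..s]"
  note cc = cfg_of_config[OF c]
  have rs: "r \<le> 0" "0 \<le> s" using c by (auto simp: is_config_def)
  interpret path ?xs "nat (- r)" using cc(1) by unfold_locales
  have len: "length ?xs = nat (- r) + nat s + 1" using cc(3) .
  have tN: "fires_at A (set ?xs) t" using t cc(2) by simp
  consider "r = 0" "s = 0" | "- r \<le> s" "0 < s" | "s \<le> - r" "r < 0" using rs by linarith
  then show ?thesis
  proof cases
    case 1
    then show ?thesis by simp
  next
    case 2
    then have "gW r s p r (s - 1) = \<infinity>" using I by (simp add: typeI_def right_free_def)
    then obtain x where x: "x \<in> W r s p r (s - 1)" "t + length ?xs < length (snd x)"
      unfolding gW_def case_prod_unfold by (rule Sup_enat_unbounded)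
    obtain x0 x1 where [simp]: "x = (x0, x1)" by (cases x)
    have b: "map p [r..s - 1] = butlast ?xs" using rs by (simp add: upto_rec2[of r s])
    then have "set (butlast ?xs) = p ` {r..s - 1}" by (metis set_map set_upto)
    then have "length ?xs - 1 + (length ?xs - 1 - nat (- r)) \<le> t"
      using x 2 len A tN unfolding W_def b cc(2)[symmetric]
      by (intro firing_time_ge[OF A tN _ refl, of x0 x1]) auto
    then show ?thesis using len 2 rs by linarith
  next
    case 3
    then have "fW r s p (r + 1) s = \<infinity>" using I by (simp add: typeI_def left_free_def)
    then obtain x where x: "x \<in> W r s p (r + 1) s" "t + length ?xs < length (fst x)"
      unfolding fW_def case_prod_unfold by (rule Sup_enat_unbounded)
    obtain x0 x1 where [simp]: "x = (x0, x1)" by (cases x)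
    interpret rev: path "rev ?xs" "length ?xs - 1 - nat (- r)"
      using cfg_list_rev[OF cc(1)] by unfold_locales
    have b: "rev (map p [r + 1..s]) = butlast (rev ?xs)" using rs by (simp add: upto_rec1[of r s])
    then have "set (butlast (rev ?xs)) = p ` {r + 1..s}" by (metis set_map set_rev set_upto)
    \<comment> \<open>Reversal swaps \<open>x0\<close> and \<open>x1\<close>, so the long left tail
      becomes the right one.\<close>
    moreover have "cfg_list (rev x1 @ butlast (rev ?xs) @ rev x0) (length (rev x1) + (length ?xs - 1 - nat (- r)))"
    proof -
      have "cfg_list (x0 @ map p [r + 1..s] @ x1) (length x0 + nat (- (r + 1)))"
        using x(1) by (simp add: W_def)
      from cfg_list_rev[OF this]
      have "cfg_list (rev x1 @ butlast (rev ?xs) @ rev x0)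
          (length (x0 @ map p [r + 1..s] @ x1) - 1 - (length x0 + nat (- (r + 1))))"
        unfolding b[symmetric] by simp
      moreover have "length (x0 @ map p [r + 1..s] @ x1) - 1 - (length x0 + nat (- (r + 1))) =
          length (rev x1) + (length ?xs - 1 - nat (- r))"
        using 3 rs unfolding length_append length_map length_rev length_upto by linarith
      ultimately show ?thesis by simp
    qed
    ultimately have "length (rev ?xs) - 1 + (length (rev ?xs) - 1 - (length ?xs - 1 - nat (- r))) \<le> t"
      using x 3 len A tN unfolding W_def cc(2)[symmetric]
      by (intro rev.firing_time_ge[OF A _ _ refl, of _ "rev x1" "rev x0"]) (auto simp: b[symmetric] Un_ac)
    then show ?thesis using len 3 rs by simp
  qed
qed

section \<open>The minimum firing time\<close>

lemma fires_at_unique: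
  assumes "fires_at A N t" "fires_at A N t'" "N \<noteq> {}"
  shows "t = t'"
proof -
  obtain v where "v \<in> N" using assms(3) by blast
  then show ?thesis
    using assms(1,2) unfolding fires_at_def by (metis linorder_neqE_nat)
qed

lemma ft_eq:
  assumes "is_config r s p" "fires_at A (cpos r s p) t"
  shows "ft r s p A = t"
proof -
  have "cpos r s p \<noteq> {}" using assms(1) by (auto simp: is_config_def cpos_def)
  then show ?thesis
    unfolding ft_def using assms(2) fires_at_unique by (metis LeastI)
qed

text \<open>Each \<open>T\<close> yields a solution that fires at time \<open>T\<close> wherever the
  formula has this value; the minimum may use a different automaton for each configuration.\<close>

lemma solution_exists:
  obtains A where "solution A"
    "\<And>r s p. is_config r s p \<Longrightarrow> T = nat (- r + s + max (- r) s) \<Longrightarrow> fires_at A (cpos r s p) T"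
proof -
  obtain A where A: "valid_fsa A"
    "\<And>N t v. run A N t v \<in> Fire A \<longleftrightarrow> srun T N t v \<in> {Fired}"
  proof (rule fsa_of_arun[of "states T" Quiet "{Fired}" "gen T" "step T"])
    show "Quiet \<in> states T" "{Fired} \<subseteq> states T" by (simp_all add: states_def)
  qed (use finite_states gen_states step_states step_quiet in auto)
  have fire: "\<exists>t. fires_at A (cpos r s p) t \<and> (T = nat (- r + s + max (- r) s) \<longrightarrow> t = T)"
    if c: "is_config r s p" for r s p
  proof -
    note cc = cfg_of_config[OF c]
    have rs: "r \<le> 0" "0 \<le> s" using c by (auto simp: is_config_def)
    interpret path "map p [r..s]" "nat (- r)" using cc(1) by unfold_locales
    obtain t where "\<And>t' v. t' < t \<Longrightarrow> v \<in> N \<Longrightarrow> srun T N t' v \<noteq> Fired"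
      "\<And>v. v \<in> N \<Longrightarrow> srun T N t v = Fired"
      "T = n - 1 + max (nat (- r)) (n - 1 - nat (- r)) \<Longrightarrow> t = T"
      using srun_fires[of T] by blast
    moreover have "n - 1 + max (nat (- r)) (n - 1 - nat (- r)) = nat (- r + s + max (- r) s)"
      using rs unfolding cc(3) by linarith
    ultimately show ?thesis
      unfolding fires_at_def A(2) cc(2)[symmetric] by (intro exI[of _ t]) auto
  qed
  show thesis
  proof (rule that)
    show "solution A" using A(1) fire unfolding solution_def by blast
  qed (use fire in blast)
qed

theorem theorem9:
  assumes "is_config r s p" and "typeI r s p"
  shows "mft r s p = enat (nat (- r + s + max (- r) s))"
proof (rule antisym)
  let ?T = "nat (- r + s + max (- r) s)"
  obtain A where A: "solution A" "fires_at A (cpos r s p) ?T"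
    using solution_exists[of ?T] assms(1) by metis
  have "mft r s p \<le> enat (ft r s p A)"
    unfolding mft_def using A(1) by (intro Inf_lower) simp
  then show "mft r s p \<le> enat ?T" using ft_eq[OF assms(1) A(2)] by simp
  show "enat ?T \<le> mft r s p"
    unfolding mft_def
  proof (rule Inf_greatest)
    fix x assume "x \<in> (\<lambda>A. enat (ft r s p A)) ` {A. solution A}"
    then obtain B where B: "solution B" "x = enat (ft r s p B)" by blast
    then obtain t where t: "fires_at B (cpos r s p) t" using assms(1) unfolding solution_def by blast
    then have "?T \<le> t" using typeI_firing_time_ge[OF assms B(1)] by blast
    then show "enat ?T \<le> x" using B(2) ft_eq[OF assms(1) t] by simp
  qed
qed

end
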